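(* Let $\Gamma$ be a nontrivial additive subgroup of $\mathbb{C}$ and let $HV=HV(\Gamma)$ be the generalized Heisenberg-Virasoro algebra with basis $\{L_{\alpha,i},H_{\alpha,i}\mid \alpha\in\Gamma,\ i\in\mathbb{Z}_+\}$, with $H=\mathrm{span}\{H_{\alpha,i}\mid\alpha\in\Gamma,\ i\in\mathbb{Z}_+\}$. Then: (1) The Lie algebra $HV$ is not finitely graded. (2) The set of ad-locally finite elements of $HV$ is $$\mathfrak{F}=\Big\{aL_{0,0}+\sum_{\alpha,j}b_{\alpha,j}H_{\alpha,j}\ (\text{finite sum})\ \Big|\ a,b_{\alpha,j}\in\mathbb{C},\ \alpha\in\Gamma,\ j\in\mathbb{Z}_+\Big\}.$$ (3) $HV$ has exactly two nonzero proper ideals: $\mathbb{C}H_{0,0}$ and $H$. In particular, $H$ is the unique maximal ideal of $HV$.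
   Context: $\mathbb{Z}_+$ denotes the nonnegative integers. For a nontrivial additive subgroup $\Gamma$ of $\mathbb{C}$, $HV=HV(\Gamma)$ is the complex Lie algebra with basis $\{L_{\alpha,i},H_{\alpha,i}\mid\alpha\in\Gamma,\ i\in\mathbb{Z}_+\}$ and brackets $$[L_{\alpha,i},L_{\beta,j}]=(\beta-\alpha)L_{\alpha+\beta,i+j}+(j-i)L_{\alpha+\beta,i+j-1},$$ $$[L_{\alpha,i},H_{\beta,j}]=\beta H_{\alpha+\beta,i+j}+jH_{\alpha+\beta,i+j-1},\qquad [H_{\alpha,i},H_{\beta,j}]=0,$$ where terms with second index $-1$ have coefficient $0$ and are read as $0$. (Concretely, $H_{\alpha,i}=x^{\alpha}t^i$ in the semigroup algebra $\mathbb{C}[\Gamma\times\mathbb{Z}_+]$, $L_{\alpha,i}=x^{\alpha}t^i\partial$ with $\partial=\partial_x+\partial_t$, $\partial_x(x^\alpha t^i)=\alpha x^\alpha t^i$, $\partial_t(x^\alpha t^i)=i x^\alpha t^{i-1}$.) A Lie algebra $\mathcal{L}$ is finitely graded if there exists an abelian group $G$ and a decomposition $\mathcal{L}=\bigoplus_{a\in G}\mathcal{L}_{[a]}$ with $[\mathcal{L}_{[a]},\mathcal{L}_{[b]}]\subset\mathcal{L}_{[a+b]}$ and $\dim\mathcal{L}_{[a]}<\infty$ for all $a,b\in G$. An element $x\in\mathcal{L}$ is ad-locally finite if for every $y\in\mathcal{L}$ the subspace $\mathrm{span}\{\mathrm{ad}_x^i(y)\mid i\in\mathbb{Z}_+\}$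 is finite-dimensional, where $\mathrm{ad}_x(y)=[x,y]$. *)

theory Defs
  imports Complex_Main "HOL-Library.Poly_Mapping" "HOL-Algebra.Group"
begin

text \<open>
  Lie algebras are given by a subset \<open>V\<close> of an ambient vector space together with a
  bracket, which is only constrained on \<open>V\<close>. A locale of
  its own is used because definitions in \<open>vector_space\<close> are captured by its existing
  interpretation for real vector spaces.
\<close>

locale lie_setting = vector_space
begin

definition lie_algebra :: "'b set \<Rightarrow> ('b \<Rightarrow> 'b \<Rightarrow> 'b) \<Rightarrow> bool" where
  "lie_algebra V br \<longleftrightarrow> subspace V \<and>
     (\<forall>x\<in>V. \<forall>y\<in>V. br x y \<in> V) \<and>
     (\<forall>x\<in>V. \<forall>y\<in>V. \<forall>z\<in>V. br (x + y) z = br x z + br y z \<and> br z (x + y) = br z x + br z y) \<and>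
     (\<forall>c. \<forall>x\<in>V. \<forall>y\<in>V. br (scale c x) y = scale c (br x y) \<and> br x (scale c y) = scale c (br x y)) \<and>
     (\<forall>x\<in>V. br x x = 0) \<and>
     (\<forall>x\<in>V. \<forall>y\<in>V. \<forall>z\<in>V. br x (br y z) + br y (br z x) + br z (br x y) = 0)"

definition lie_ideal :: "'b set \<Rightarrow> ('b \<Rightarrow> 'b \<Rightarrow> 'b) \<Rightarrow> 'b set \<Rightarrow> bool" where
  "lie_ideal V br I \<longleftrightarrow> subspace I \<and> I \<subseteq> V \<and> (\<forall>x\<in>V. \<forall>y\<in>I. br x y \<in> I)"

definition maximal_lie_ideal :: "'b set \<Rightarrow> ('b \<Rightarrow> 'b \<Rightarrow> 'b) \<Rightarrow> 'b set \<Rightarrow> bool" where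
  "maximal_lie_ideal V br I \<longleftrightarrow> lie_ideal V br I \<and> I \<noteq> V \<and>
     (\<forall>J. lie_ideal V br J \<longrightarrow> I \<subseteq> J \<longrightarrow> J = I \<or> J = V)"

definition fin_dim_subspace :: "'b set \<Rightarrow> bool" where
  "fin_dim_subspace W \<longleftrightarrow> (\<exists>B. finite B \<and> W = span B)"

definition ad_locally_finite :: "'b set \<Rightarrow> ('b \<Rightarrow> 'b \<Rightarrow> 'b) \<Rightarrow> 'b \<Rightarrow> bool" where
  "ad_locally_finite V br x \<longleftrightarrow>
     (\<forall>y\<in>V. fin_dim_subspace (span {(br x ^^ i) y | i. True}))"

text \<open>
  \<open>direct_sum_decomp A D V\<close>: the subspaces \<open>D a\<close>, for \<open>a \<in> A\<close>, lie in \<open>V\<close>, and every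
  element of \<open>V\<close> is in a unique way a finite sum of elements of them.
\<close>

definition direct_sum_decomp :: "'g set \<Rightarrow> ('g \<Rightarrow> 'b set) \<Rightarrow> 'b set \<Rightarrow> bool" where
  "direct_sum_decomp A D V \<longleftrightarrow>
     (\<forall>a\<in>A. subspace (D a) \<and> D a \<subseteq> V) \<and>
     (\<forall>v\<in>V. \<exists>!f. (\<forall>a\<in>A. f a \<in> D a) \<and> (\<forall>a. a \<notin> A \<longrightarrow> f a = 0) \<and>
        finite {a. f a \<noteq> 0} \<and> v = (\<Sum>a | f a \<noteq> 0. f a))"

text \<open>
  HOL has no quantifier over types inside a formula, so the type \<open>'g\<close> hosting the abelian
  grading group is a parameter; a theorem denying the property for a type variable \<open>'g\<close>
  denies it for every grading group. The group operation is written multiplicatively.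
\<close>

definition finitely_graded :: "'g itself \<Rightarrow> 'b set \<Rightarrow> ('b \<Rightarrow> 'b \<Rightarrow> 'b) \<Rightarrow> bool" where
  "finitely_graded (_ :: 'g itself) V br \<longleftrightarrow>
     (\<exists>(G :: 'g monoid) D. comm_group G \<and>
        direct_sum_decomp (carrier G) D V \<and>
        (\<forall>a\<in>carrier G. \<forall>b\<in>carrier G. \<forall>x\<in>D a. \<forall>y\<in>D b. br x y \<in> D (a \<otimes>\<^bsub>G\<^esub> b)) \<and>
        (\<forall>a\<in>carrier G. fin_dim_subspace (D a)))"

end

datatype hv_index = Lx complex nat | Hx complex nat

text \<open>
  The ambient space has basis indexed by all of \<open>\<complex> \<times> \<nat>\<close>; the subgroup \<open>\<Gamma>\<close> only enters
  through the subspace \<open>HV \<Gamma>\<close> below.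
\<close>

type_synonym hv = "hv_index \<Rightarrow>\<^sub>0 complex"

definition hv_scale :: "complex \<Rightarrow> hv \<Rightarrow> hv" (infixr \<open>*\<^sub>h\<close> 75) where
  "c *\<^sub>h x = Poly_Mapping.map ((*) c) x"

lemma lookup_hv_scale [simp]: "Poly_Mapping.lookup (c *\<^sub>h x) k = c * Poly_Mapping.lookup x k"
  by (simp add: hv_scale_def Poly_Mapping.map.rep_eq when_def)

global_interpretation hv: lie_setting hv_scale
  by unfold_locales (auto intro!: poly_mapping_eqI simp: lookup_add algebra_simps)

abbreviation hv_basis :: "hv_index \<Rightarrow> hv" where
  "hv_basis k \<equiv> Poly_Mapping.single k 1"

definition L :: "complex \<Rightarrow> nat \<Rightarrow> hv" where "L \<alpha> i = hv_basis (Lx \<alpha> i)"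
definition H :: "complex \<Rightarrow> nat \<Rightarrow> hv" where "H \<alpha> i = hv_basis (Hx \<alpha> i)"

text \<open>
  Subtraction on \<open>nat\<close> truncates, but a second index \<open>i + j - 1\<close> with \<open>i = j = 0\<close> always
  comes with coefficient \<open>0\<close>.
\<close>

fun hv_basis_bracket :: "hv_index \<Rightarrow> hv_index \<Rightarrow> hv" where
  "hv_basis_bracket (Lx \<alpha> i) (Lx \<beta> j) =
     (\<beta> - \<alpha>) *\<^sub>h L (\<alpha> + \<beta>) (i + j) + (of_nat j - of_nat i) *\<^sub>h L (\<alpha> + \<beta>) (i + j - 1)"
| "hv_basis_bracket (Lx \<alpha> i) (Hx \<beta> j) =
     \<beta> *\<^sub>h H (\<alpha> + \<beta>) (i + j) + of_nat j *\<^sub>h H (\<alpha> + \<beta>) (i + j - 1)"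
| "hv_basis_bracket (Hx \<alpha> i) (Lx \<beta> j) =
     - (\<alpha> *\<^sub>h H (\<beta> + \<alpha>) (j + i) + of_nat i *\<^sub>h H (\<beta> + \<alpha>) (j + i - 1))"
| "hv_basis_bracket (Hx \<alpha> i) (Hx \<beta> j) = 0"

definition hv_bracket :: "hv \<Rightarrow> hv \<Rightarrow> hv" where
  "hv_bracket x y =
     (\<Sum>k\<in>Poly_Mapping.keys x. \<Sum>l\<in>Poly_Mapping.keys y.
        (Poly_Mapping.lookup x k * Poly_Mapping.lookup y l) *\<^sub>h hv_basis_bracket k l)"

definition HV :: "complex set \<Rightarrow> hv set" where
  "HV \<Gamma> = hv.span ({L \<alpha> i | \<alpha> i. \<alpha> \<in> \<Gamma>} \<union> {H \<alpha> i | \<alpha> i. \<alpha> \<in> \<Gamma>})"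

definition HV_H :: "complex set \<Rightarrow> hv set" where
  "HV_H \<Gamma> = hv.span {H \<alpha> i | \<alpha> i. \<alpha> \<in> \<Gamma>}"

lemma hv_basis_independent: "hv.independent (range hv_basis)"
proof -
  have inj: "inj hv_basis" by (rule injI) (metis keys_single singleton_inject zero_neq_one)
  show ?thesis
    unfolding hv.dependent_explicit
  proof (clarify)
    fix S u v assume S: "finite S" "S \<subseteq> range hv_basis" and z: "(\<Sum>v\<in>S. u v *\<^sub>h v) = 0"
      and v: "v \<in> S" "u v \<noteq> 0"
    from v S obtain k where k: "v = hv_basis k" by auto
    have "0 = Poly_Mapping.lookup (\<Sum>v\<in>S. u v *\<^sub>h v) k" by (simp add: z)
    also have "\<dots> = (\<Sum>w\<in>S. if w = v then u v else 0)"
      unfolding lookup_sum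
    proof (rule sum.cong)
      fix w assume "w \<in> S"
      then obtain l where l: "w = hv_basis l" using S by auto
      show "Poly_Mapping.lookup (u w *\<^sub>h w) k = (if w = v then u v else 0)"
        by (auto simp: l k lookup_single when_def dest: injD[OF inj])
    qed simp
    also have "\<dots> = u v" using S v by simp
    finally show False using v by simp
  qed
qed

lemma hv_bracket_superset:
  assumes "finite A" "Poly_Mapping.keys x \<subseteq> A" "finite B" "Poly_Mapping.keys y \<subseteq> B"
  shows "hv_bracket x y = (\<Sum>k\<in>A. \<Sum>l\<in>B. (Poly_Mapping.lookup x k * Poly_Mapping.lookup y l) *\<^sub>h hv_basis_bracket k l)"
proof -
  have "hv_bracket x y = (\<Sum>k\<in>Poly_Mapping.keys x. \<Sum>l\<in>B. (Poly_Mapping.lookup x k * Poly_Mapping.lookup y l) *\<^sub>h hv_basis_bracket k l)"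
    unfolding hv_bracket_def
    by (intro sum.cong sum.mono_neutral_left refl) (use assms in \<open>auto simp: in_keys_iff\<close>)
  also have "\<dots> = (\<Sum>k\<in>A. \<Sum>l\<in>B. (Poly_Mapping.lookup x k * Poly_Mapping.lookup y l) *\<^sub>h hv_basis_bracket k l)"
    by (intro sum.mono_neutral_left) (use assms in \<open>auto simp: in_keys_iff\<close>)
  finally show ?thesis .
qed

lemma hv_bracket_add_left: "hv_bracket (x + y) z = hv_bracket x z + hv_bracket y z"
proof -
  let ?A = "Poly_Mapping.keys x \<union> Poly_Mapping.keys y"
  have "Poly_Mapping.keys (x + y) \<subseteq> ?A" by (rule Poly_Mapping.keys_add)
  then show ?thesis
    by (simp add: hv_bracket_superset[of ?A _ "Poly_Mapping.keys z"] lookup_add algebra_simps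
        hv.scale_left_distrib sum.distrib)
qed

lemma hv_bracket_scale_left: "hv_bracket (c *\<^sub>h x) y = c *\<^sub>h hv_bracket x y"
proof -
  have "Poly_Mapping.keys (c *\<^sub>h x) \<subseteq> Poly_Mapping.keys x" by (auto simp: in_keys_iff)
  then show ?thesis
    by (simp add: hv_bracket_superset[of "Poly_Mapping.keys x" _ "Poly_Mapping.keys y"] hv.scale_sum_right mult.assoc)
qed

lemma hv_basis_bracket_swap: "hv_basis_bracket l k = - hv_basis_bracket k l"
  by (cases k; cases l) (simp_all add: add.commute hv.scale_left_diff_distrib)

lemma hv_bracket_swap: "hv_bracket y x = - hv_bracket x y"
proof -
  have "hv_bracket y x =
      (\<Sum>k\<in>Poly_Mapping.keys x. \<Sum>l\<in>Poly_Mapping.keys y.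
        (Poly_Mapping.lookup y l * Poly_Mapping.lookup x k) *\<^sub>h hv_basis_bracket l k)"
    unfolding hv_bracket_def by (rule sum.swap)
  also have "\<dots> = - hv_bracket x y"
    by (subst hv_basis_bracket_swap) (simp add: hv_bracket_def sum_negf mult.commute)
  finally show ?thesis .
qed

lemma hv_bracket_add_right: "hv_bracket z (x + y) = hv_bracket z x + hv_bracket z y"
  by (simp only: hv_bracket_swap[of z _] hv_bracket_add_left minus_add_distrib)

lemma hv_bracket_scale_right: "hv_bracket x (c *\<^sub>h y) = c *\<^sub>h hv_bracket x y"
  by (simp only: hv_bracket_swap[of x _] hv_bracket_scale_left hv.scale_minus_right)

lemma hv_bracket_zero [simp]: "hv_bracket 0 x = 0" "hv_bracket x 0 = 0"
  by (simp_all add: hv_bracket_def)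

lemma hv_bracket_minus: "hv_bracket (- x) y = - hv_bracket x y" "hv_bracket y (- x) = - hv_bracket y x"
  using hv_bracket_scale_left[of "-1" x y] hv_bracket_scale_right[of y "-1" x] by simp_all

lemma hv_bracket_self: "hv_bracket x x = 0"
proof -
  have "hv_bracket x x + hv_bracket x x = 0"
    using hv_bracket_swap[of x x] by (metis add.right_inverse)
  then have "2 *\<^sub>h hv_bracket x x = 0"
    using hv.scale_left_distrib[of 1 1 "hv_bracket x x"] by simp
  then show ?thesis by simp
qed

lemma hv_bracket_basis: "hv_bracket (hv_basis k) (hv_basis l) = hv_basis_bracket k l"
  by (simp add: hv_bracket_def)

lemmas hv_bracket_basis_simps =
  hv_bracket_basis[of "Lx \<alpha> i" "Lx \<beta> j" for \<alpha> \<beta> i j, folded L_def H_def, simplified]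
  hv_bracket_basis[of "Lx \<alpha> i" "Hx \<beta> j" for \<alpha> \<beta> i j, folded L_def H_def, simplified]
  hv_bracket_basis[of "Hx \<alpha> i" "Lx \<beta> j" for \<alpha> \<beta> i j, folded L_def H_def, simplified]
  hv_bracket_basis[of "Hx \<alpha> i" "Hx \<beta> j" for \<alpha> \<beta> i j, folded L_def H_def, simplified]

lemma hv_span_basis: "hv.span (range hv_basis) = UNIV"
proof -
  have "x \<in> hv.span (range hv_basis)" for x :: hv
  proof -
    have "x = (\<Sum>k\<in>Poly_Mapping.keys x. Poly_Mapping.lookup x k *\<^sub>h hv_basis k)"
      by (rule poly_mapping_eqI) (auto simp: lookup_sum lookup_single when_def in_keys_iff
          if_distrib[of "(*) _"] cong: if_cong)
    then show ?thesis
      by (metis (no_types, lifting) hv.span_sum hv.span_scale hv.span_base rangeI)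
  qed
  then show ?thesis by blast
qed

lemma hv_bracket_diff_right: "hv_bracket x (y - z) = hv_bracket x y - hv_bracket x z"
  using hv_bracket_add_right[of x y "-z"] by (simp add: hv_bracket_minus)

definition hv_jac :: "hv \<Rightarrow> hv \<Rightarrow> hv \<Rightarrow> hv" where
  "hv_jac x y z =
  hv_bracket x (hv_bracket y z) + hv_bracket y (hv_bracket z x) + hv_bracket z (hv_bracket x y)"

lemma hv_scale_twice: "(a * 2) *\<^sub>h x = a *\<^sub>h x + a *\<^sub>h x"
  by (simp flip: hv.scale_left_distrib)

lemma hv_jac_LLL:
  "hv_jac (L \<alpha> i) (L \<beta> j) (L \<gamma> k) = 0"
  unfolding hv_jac_def
  apply (cases i; cases j; cases k)
  apply (simp_all add: hv_bracket_basis_simps hv_bracket_add_right hv_bracket_scale_right)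
  apply (simp_all add: algebra_simps hv_scale_twice)
  done

lemma hv_jac_LLH:
  "hv_jac (L \<alpha> i) (L \<beta> j) (H \<gamma> k) = 0"
  unfolding hv_jac_def
  apply (cases i; cases j; cases k)
  apply (simp_all add: hv_bracket_basis_simps hv_bracket_add_right hv_bracket_scale_right hv_bracket_minus hv_bracket_diff_right)
  apply (simp_all add: algebra_simps hv_scale_twice)
  done

lemma hv_jac_LHH:
  "hv_jac (L \<alpha> i) (H \<beta> j) (H \<gamma> k) = 0"
  "hv_jac (H \<alpha> i) (H \<beta> j) (H \<gamma> k) = 0"
  unfolding hv_jac_def
  by (simp_all add: hv_bracket_basis_simps hv_bracket_add_right hv_bracket_scale_right hv_bracket_minus hv_bracket_diff_right)

lemma hv_jac_cycle: "hv_jac y z x = hv_jac x y z"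
  by (simp add: hv_jac_def add_ac)

lemma hv_jac_lin: 
  "hv_jac (x + x') y z = hv_jac x y z + hv_jac x' y z"
  "hv_jac (c *\<^sub>h x) y z = c *\<^sub>h hv_jac x y z"
  unfolding hv_jac_def
  by (simp_all add: hv_bracket_add_left hv_bracket_add_right hv_bracket_scale_left
     hv_bracket_scale_right add_ac hv.scale_right_distrib)

lemma hv_bracket_closed:
  assumes "\<And>a b. a \<in> \<Gamma> \<Longrightarrow> b \<in> \<Gamma> \<Longrightarrow> a + b \<in> \<Gamma>"
  assumes "x \<in> HV \<Gamma>" "y \<in> HV \<Gamma>"
  shows "hv_bracket x y \<in> HV \<Gamma>"
proof -
  let ?B = "{L \<alpha> i | \<alpha> i. \<alpha> \<in> \<Gamma>} \<union> {H \<alpha> i | \<alpha> i. \<alpha> \<in> \<Gamma>}"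
  have sub: "hv.subspace (HV \<Gamma>)" by (simp add: HV_def)
  have base: "L \<alpha> i \<in> HV \<Gamma>" "H \<alpha> i \<in> HV \<Gamma>" if "\<alpha> \<in> \<Gamma>" for \<alpha> i
    unfolding HV_def using that by (blast intro: hv.span_base)+
  note clo = hv.subspace_add[OF sub] hv.subspace_diff[OF sub] hv.subspace_neg[OF sub]
    hv.subspace_scale[OF sub] hv.subspace_0[OF sub]
  have 1: "hv_bracket x y \<in> HV \<Gamma>" if "x \<in> ?B" "y \<in> ?B" for x y
    using that by (auto simp: hv_bracket_basis_simps assms(1) intro!: base clo)
  have 2: "hv_bracket x y \<in> HV \<Gamma>" if x: "x \<in> ?B" and y: "y \<in> hv.span ?B" for x y
    using y
  proof (induction rule: hv.span_induct_alt)
    case base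
    then show ?case by (simp add: clo)
  next
    case (step c b y)
    then show ?case using 1[OF x step(1)]
      by (simp add: hv_bracket_add_right hv_bracket_scale_right clo)
  qed
  from assms(2) have "x \<in> hv.span ?B" by (simp add: HV_def)
  then show ?thesis
  proof (induction rule: hv.span_induct_alt)
    case base
    then show ?case by (simp add: clo)
  next
    case (step c b x)
    have "hv_bracket b y \<in> HV \<Gamma>"
      using 2[OF step(1)] assms(3) by (simp add: HV_def)
    with step(2) show ?case
      by (simp add: hv_bracket_add_left hv_bracket_scale_left clo)
  qed
qed

lemma hv_jac_zero: "hv_jac x y z = 0"
proof -
  have hv_basis_cases: "\<exists>\<alpha> i. b = L \<alpha> i \<or> b = H \<alpha> i" if "b \<in> range hv_basis" for b
  proof -
    from that obtain k where "b = hv_basis k" by blast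
    then show ?thesis by (cases k) (auto simp: L_def H_def)
  qed
  have basis: "hv_jac b c d = 0"
    if "b \<in> range hv_basis" "c \<in> range hv_basis" "d \<in> range hv_basis" for b c d
    using hv_basis_cases[OF that(1)] hv_basis_cases[OF that(2)] hv_basis_cases[OF that(3)]
    by (auto simp: hv_jac_LLL hv_jac_LLH hv_jac_LHH)
      (metis hv_jac_LLH hv_jac_LHH hv_jac_cycle)+
  have ext: "hv_jac x b c = 0" if "\<And>d. d \<in> range hv_basis \<Longrightarrow> hv_jac d b c = 0" for x b c
  proof -
    have "x \<in> hv.span (range hv_basis)" by (simp add: hv_span_basis)
    then show ?thesis
    proof (induction rule: hv.span_induct_alt)
      case base
      then show ?case by (simp add: hv_jac_def)
    next
      case (step c b x)
      then show ?case by (simp add: hv_jac_lin that)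
    qed
  qed
  show ?thesis
    by (rule ext, subst hv_jac_cycle[symmetric], rule ext, subst hv_jac_cycle[symmetric],
        rule ext, rule basis)
qed

lemma lie_algebra_HV:
  assumes "\<And>a b. a \<in> \<Gamma> \<Longrightarrow> b \<in> \<Gamma> \<Longrightarrow> a + b \<in> \<Gamma>"
  shows "hv.lie_algebra (HV \<Gamma>) hv_bracket"
  unfolding hv.lie_algebra_def
  using hv_jac_zero hv_bracket_closed[of \<Gamma>, OF assms]
  by (auto simp: HV_def hv_bracket_add_left hv_bracket_add_right hv_bracket_scale_left
      hv_bracket_scale_right hv_bracket_self hv_jac_def)

end

theory Submission
  imports Defs "HOL-Library.Product_Lexorder"
begin

text \<open>
  Write \<open>\<partial>\<close> for \<open>L 0 0\<close>, so that \<open>HV\<close> consists of the elements \<open>f \<partial> + h\<close> with \<open>f, h \<in> \<complex>[\<Gamma> \<times> \<nat>]\<close>.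

  Order \<open>\<Gamma> \<times> \<nat>\<close> lexicographically, with either sign on \<open>\<Gamma>\<close>. If \<open>f\<close> has leading exponent \<open>(\<alpha>, i)\<close>, the
  \<open>n\<close>-th iterate of \<open>ad (f \<partial> + h)\<close> on a suitable \<open>H \<beta> 0\<close> has leading exponent \<open>(\<beta> + n \<alpha>, n i)\<close>. Hence
  \<open>f \<partial> + h\<close> is never ad-nilpotent for \<open>f \<noteq> 0\<close>, and ad-locally finite only for constant \<open>f\<close>.

  An ideal is stable under \<open>ad \<partial>\<close>, whose generalized eigenspaces are the parts of fixed degree in \<open>\<Gamma>\<close>;
  it therefore contains eigenvectors, and these generate \<open>H\<close> or everything.

  Suppose \<open>HV\<close> is finitely graded, and let \<open>x = a \<partial> + h\<close>, \<open>a \<noteq> 0\<close>, have as few homogeneous components as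
  possible. If a degree of \<open>x\<close> has infinite order, the component of \<open>x\<close> in an extremal degree is
  ad-nilpotent because \<open>x\<close> is ad-locally finite, so it lies in \<open>H\<close> and can be dropped. So all degrees of
  \<open>x\<close> are torsion, and \<open>ad x\<close> preserves a finite-dimensional sum of homogeneous components. As \<open>ad x\<close>
  acts on the \<open>H 0 n\<close> like a multiple of \<open>d/dt\<close> on the \<open>t^n\<close>, this is impossible.
\<close>

subsection \<open>Preorders on abelian groups\<close>

context comm_group
begin

definition torsion :: "'a set" where
  "torsion = {g \<in> carrier G. \<exists>n>0. g [^] (n::nat) = \<one>}"

lemma torsion_subset: "torsion \<subseteq> carrier G"
  by (auto simp: torsion_def)

lemma one_torsion: "\<one> \<in> torsion"
  by (auto simp: torsion_def intro!: exI[of _ 1])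

lemma torsion_mult:
  assumes "g \<in> torsion" "h \<in> torsion"
  shows "g \<otimes> h \<in> torsion"
proof -
  from assms obtain m n :: nat where mn: "m > 0" "n > 0" "g [^] m = \<one>" "h [^] n = \<one>"
    and c: "g \<in> carrier G" "h \<in> carrier G"
    by (auto simp: torsion_def)
  have "(g \<otimes> h) [^] (m * n) = g [^] (m * n) \<otimes> h [^] (n * m)"
    using c by (simp add: pow_mult_distrib m_comm mult.commute)
  also have "\<dots> = (g [^] m) [^] n \<otimes> (h [^] n) [^] m"
    using c by (simp add: nat_pow_pow)
  also have "\<dots> = \<one>" by (simp add: mn)
  finally show ?thesis
    using c mn by (auto simp: torsion_def intro!: exI[of _ "m * n"])
qed

lemma torsion_inv: "g \<in> torsion \<Longrightarrow> inv g \<in> torsion"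
  by (auto simp: torsion_def nat_pow_inv)

lemma torsion_root:
  assumes "g \<in> carrier G" "g [^] n \<in> torsion" "(n::nat) > 0"
  shows "g \<in> torsion"
proof -
  from assms(2) obtain m :: nat where "m > 0" "(g [^] n) [^] m = \<one>"
    by (auto simp: torsion_def)
  with assms show ?thesis
    by (auto simp: torsion_def nat_pow_pow intro!: exI[of _ "n * m"])
qed

text \<open>Preimage in \<open>G\<close> of the nonnegative cone of a partial order on
  \<open>G\<close> modulo torsion. Closure under roots is what allows a further element to be
  adjoined: it turns a power of \<open>inv s\<close> lying in \<open>P\<close> into
  \<open>inv s\<close> itself.\<close>

definition pure_cone :: "'a set \<Rightarrow> bool" where
  "pure_cone P \<longleftrightarrow> torsion \<subseteq> P \<and> P \<subseteq> carrier G \<and> (\<forall>g\<in>P. \<forall>h\<in>P. g \<otimes> h \<in> P) \<and>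
     (\<forall>g\<in>carrier G. \<forall>n>0. g [^] (n::nat) \<in> P \<longrightarrow> g \<in> P) \<and>
     (\<forall>g\<in>P. inv g \<in> P \<longrightarrow> g \<in> torsion)"

lemma pure_cone_pow: "pure_cone P \<Longrightarrow> g \<in> P \<Longrightarrow> g [^] (n::nat) \<in> P"
  using one_torsion by (induction n) (auto simp: pure_cone_def)

text \<open>Reversing the order, used to choose the sign of a given element.\<close>

lemma pure_cone_inv:
  assumes "pure_cone P"
  shows "pure_cone {g \<in> carrier G. inv g \<in> P}"
  unfolding pure_cone_def
proof (intro conjI ballI allI impI)
  show "torsion \<subseteq> {g \<in> carrier G. inv g \<in> P}"
    using assms torsion_inv torsion_subset unfolding pure_cone_def by auto
next
  fix g h assume "g \<in> {g \<in> carrier G. inv g \<in> P}" "h \<in> {g \<in> carrier G. inv g \<in> P}"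
  then show "g \<otimes> h \<in> {g \<in> carrier G. inv g \<in> P}"
    using assms by (auto simp: pure_cone_def inv_mult)
next
  fix g and n :: nat assume "g \<in> carrier G" "0 < n" "g [^] n \<in> {g \<in> carrier G. inv g \<in> P}"
  then show "g \<in> {g \<in> carrier G. inv g \<in> P}"
    using assms unfolding pure_cone_def by (auto simp flip: nat_pow_inv)
next
  fix g assume "g \<in> {g \<in> carrier G. inv g \<in> P}" "inv g \<in> {g \<in> carrier G. inv g \<in> P}"
  then show "g \<in> torsion"
    using assms unfolding pure_cone_def by auto
qed auto

text \<open>If \<open>inv s\<close> is not in \<open>P\<close>, then \<open>s\<close> can be
  declared nonnegative: \<open>P'\<close> is the root closure of the monoid generated by
  \<open>P\<close> and \<open>s\<close>. An element and its inverse both in \<open>P'\<close> would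
  put a power of \<open>inv s\<close> into \<open>P\<close>; closure under roots forces the exponent
  to be zero, and antisymmetry of \<open>P\<close> modulo torsion applies.\<close>

lemma pure_cone_extend:
  assumes P: "pure_cone P" and s: "s \<in> carrier G"
  shows "\<exists>P'. pure_cone P' \<and> P \<subseteq> P' \<and> (s \<in> P' \<or> inv s \<in> P')"
proof (cases "inv s \<in> P")
  case True
  then show ?thesis using P by blast
next
  case False
  have PG: "P \<subseteq> carrier G" and Pm: "\<And>g h. g \<in> P \<Longrightarrow> h \<in> P \<Longrightarrow> g \<otimes> h \<in> P"
    and Pr: "\<And>g n. g \<in> carrier G \<Longrightarrow> (n::nat) > 0 \<Longrightarrow> g [^] n \<in> P \<Longrightarrow> g \<in> P"
    and Pi: "\<And>g. g \<in> P \<Longrightarrow> inv g \<in> P \<Longrightarrow> g \<in> torsion" and PT: "torsion \<subseteq> P"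
    using P unfolding pure_cone_def by blast+
  have P1: "\<one> \<in> P" using PT one_torsion by blast
  define P' where "P' = {g \<in> carrier G. \<exists>k>0. \<exists>n. \<exists>p\<in>P. g [^] (k::nat) = p \<otimes> s [^] (n::nat)}"
  have "P \<subseteq> P'"
  proof
    fix g assume "g \<in> P"
    then have "g [^] (1::nat) = g \<otimes> s [^] (0::nat)" "g \<in> carrier G" using PG by auto
    with \<open>g \<in> P\<close> show "g \<in> P'" unfolding P'_def by (blast intro: zero_less_one)
  qed
  moreover have "s \<in> P'"
  proof -
    have "s [^] (1::nat) = \<one> \<otimes> s [^] (1::nat)" using s by simp
    with P1 s show ?thesis unfolding P'_def by (blast intro: zero_less_one)
  qed
  moreover have "pure_cone P'"
    unfolding pure_cone_def
  proof (intro conjI ballI allI impI)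
    show "torsion \<subseteq> P'" using PT \<open>P \<subseteq> P'\<close> by blast
    show "P' \<subseteq> carrier G" by (auto simp: P'_def)
  next
    fix g h assume "g \<in> P'" "h \<in> P'"
    then obtain k l m n :: nat and p q where *: "g \<in> carrier G" "h \<in> carrier G" "k > 0" "l > 0"
      "p \<in> P" "q \<in> P" "g [^] k = p \<otimes> s [^] m" "h [^] l = q \<otimes> s [^] n"
      unfolding P'_def by blast
    then have c: "p \<in> carrier G" "q \<in> carrier G" using PG by auto
    have "(g \<otimes> h) [^] (k * l) = (g [^] k) [^] l \<otimes> (h [^] l) [^] k"
      using nat_pow_pow[of g k l] nat_pow_pow[of h l k] *(1,2)
      by (simp add: pow_mult_distrib m_comm mult.commute)
    also have "\<dots> = (p [^] l \<otimes> q [^] k) \<otimes> s [^] (m * l + n * k)"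
      using * c s by (simp add: pow_mult_distrib m_comm nat_pow_pow m_ac flip: nat_pow_mult)
    finally have "(g \<otimes> h) [^] (k * l) = (p [^] l \<otimes> q [^] k) \<otimes> s [^] (m * l + n * k)" .
    moreover have "p [^] l \<otimes> q [^] k \<in> P" "k * l > 0"
      using * pure_cone_pow[OF P] Pm by auto
    ultimately show "g \<otimes> h \<in> P'" using * unfolding P'_def by blast
  next
    fix g and n :: nat assume g: "g \<in> carrier G" "0 < n" "g [^] n \<in> P'"
    then obtain k m :: nat and p where "k > 0" "p \<in> P" "(g [^] n) [^] k = p \<otimes> s [^] m"
      unfolding P'_def by blast
    then have "n * k > 0" "p \<in> P" "g [^] (n * k) = p \<otimes> s [^] m"
      using g by (auto simp: nat_pow_pow)
    then show "g \<in> P'" using g unfolding P'_def by blast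
  next
    fix g assume "g \<in> P'" "inv g \<in> P'"
    then obtain k l m n :: nat and p q where *: "g \<in> carrier G" "k > 0" "l > 0"
      "p \<in> P" "q \<in> P" "g [^] k = p \<otimes> s [^] m" "inv g [^] l = q \<otimes> s [^] n"
      unfolding P'_def by blast
    then have c: "p \<in> carrier G" "q \<in> carrier G" using PG by auto
    have "\<one> = (g [^] k) [^] l \<otimes> (inv g [^] l) [^] k"
      using *(1) by (metis inv_closed mult.commute nat_pow_closed nat_pow_inv nat_pow_pow r_inv)
    also have "\<dots> = (p [^] l \<otimes> q [^] k) \<otimes> s [^] (m * l + n * k)"
      using * c s by (simp add: pow_mult_distrib m_comm nat_pow_pow m_ac flip: nat_pow_mult)
    finally have "inv (s [^] (m * l + n * k)) = p [^] l \<otimes> q [^] k"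
      using c s by (metis inv_equality m_closed nat_pow_closed)
    then have "inv s [^] (m * l + n * k) \<in> P"
      using * pure_cone_pow[OF P] Pm s by (simp add: nat_pow_inv)
    then have "m * l + n * k = 0"
      using False Pr[of "inv s" "m * l + n * k"] s by (metis inv_closed gr0I)
    then have "m = 0" "n = 0" using * by auto
    then have "g [^] k \<in> P" "inv g [^] l \<in> P" using * c by auto
    then show "g \<in> torsion" using Pi[of g] Pr[of g k] Pr[of "inv g" l] * by auto
  qed
  ultimately show ?thesis by blast
qed

text \<open>Only finitely many comparisons matter later, so it suffices to extend the trivial cone
  \<open>torsion\<close> one element at a time; no total order on the whole group is built.\<close>

lemma pure_cone_total_on_finite:
  assumes "finite E" "E \<subseteq> carrier G"
  shows "\<exists>P. pure_cone P \<and> (\<forall>g\<in>E. g \<in> P \<or> inv g \<in> P)"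
  using assms
proof (induction E rule: finite_induct)
  case empty
  have "pure_cone torsion"
    using torsion_subset torsion_mult torsion_root by (auto simp: pure_cone_def)
  then show ?case by blast
next
  case (insert s E)
  then obtain P where P: "pure_cone P" "\<forall>g\<in>E. g \<in> P \<or> inv g \<in> P" by auto
  obtain P' where "pure_cone P'" "P \<subseteq> P'" "s \<in> P' \<or> inv s \<in> P'"
    using pure_cone_extend[OF P(1), of s] insert.prems by auto
  then show ?case using P(2) by (intro exI[of _ P']) auto
qed

text \<open>Choose \<open>a\<close> maximal in \<open>S\<close> for an order in which
  \<open>s\<close> is positive. It cannot be torsion, since otherwise \<open>s\<close>, being at
  most \<open>a\<close>, would be at most zero modulo torsion.\<close>

lemma ex_extremal:
  assumes S: "finite S" "S \<subseteq> carrier G" and s: "s \<in> S" "s \<notin> torsion"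
  shows "\<exists>P a. pure_cone P \<and> a \<in> S \<and> a \<notin> torsion \<and> (\<forall>b\<in>S. a \<otimes> inv b \<in> P)"
proof -
  \<comment> \<open>The quotients make the elements of \<open>S\<close> pairwise comparable;
    \<open>s\<close> is included so that its sign can be fixed.\<close>
  define E where "E = insert s ((\<lambda>(a, b). a \<otimes> inv b) ` (S \<times> S))"
  have "finite E" "E \<subseteq> carrier G" using S s by (auto simp: E_def)
  then obtain P0 where P0: "pure_cone P0" "\<And>g. g \<in> E \<Longrightarrow> g \<in> P0 \<or> inv g \<in> P0"
    using pure_cone_total_on_finite by metis
  \<comment> \<open>If \<open>s\<close> is negative, pass to the reversed order.\<close>
  obtain P where P: "pure_cone P" "\<And>g. g \<in> E \<Longrightarrow> g \<in> P \<or> inv g \<in> P" "s \<in> P"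
  proof (cases "s \<in> P0")
    case True
    then show ?thesis using that P0 by blast
  next
    case False
    then have "inv s \<in> P0" using P0(2)[of s] by (simp add: E_def)
    show ?thesis
    proof (rule that[of "{g \<in> carrier G. inv g \<in> P0}"])
      fix g assume "g \<in> E"
      then show "g \<in> {g \<in> carrier G. inv g \<in> P0} \<or> inv g \<in> {g \<in> carrier G. inv g \<in> P0}"
        using P0(2)[of g] \<open>E \<subseteq> carrier G\<close> by auto
    qed (use pure_cone_inv[OF P0(1)] \<open>inv s \<in> P0\<close> S s in auto)
  qed
  have PG: "P \<subseteq> carrier G" and Pm: "\<And>g h. g \<in> P \<Longrightarrow> h \<in> P \<Longrightarrow> g \<otimes> h \<in> P"
    and Pi: "\<And>g. g \<in> P \<Longrightarrow> inv g \<in> P \<Longrightarrow> g \<in> torsion" and PT: "torsion \<subseteq> P"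
    using P(1) unfolding pure_cone_def by blast+
  have total: "a \<otimes> inv b \<in> P \<or> b \<otimes> inv a \<in> P" if "a \<in> S" "b \<in> S" for a b
  proof -
    have "a \<otimes> inv b \<in> E" using that by (auto simp: E_def)
    then have "a \<otimes> inv b \<in> P \<or> inv (a \<otimes> inv b) \<in> P" by (rule P(2))
    moreover have "inv (a \<otimes> inv b) = b \<otimes> inv a"
      using that S by (auto simp: inv_mult m_comm subset_iff)
    ultimately show ?thesis by simp
  qed
  have "\<exists>a\<in>F. \<forall>b\<in>F. a \<otimes> inv b \<in> P" if "finite F" "F \<noteq> {}" "F \<subseteq> S" for F
    using that
  proof (induction F rule: finite_ne_induct)
    case (singleton a)
    then show ?case using total[of a a] by simp
  next
    case (insert c F)
    then obtain a where a: "a \<in> F" "\<forall>b\<in>F. a \<otimes> inv b \<in> P" by auto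
    show ?case
    proof (cases "a \<otimes> inv c \<in> P")
      case True
      then show ?thesis using a by auto
    next
      case False
      then have ca: "c \<otimes> inv a \<in> P" using total[of a c] a insert.prems by auto
      have "c \<otimes> inv b \<in> P" if "b \<in> F" for b
      proof -
        have "c \<otimes> inv b = (c \<otimes> inv a) \<otimes> (a \<otimes> inv b)"
        proof -
          have "a \<in> carrier G" "b \<in> carrier G" "c \<in> carrier G"
            using that insert.prems a(1) S by auto
          then show ?thesis by (metis inv_closed inv_solve_left m_assoc m_closed)
        qed
        then show ?thesis using Pm ca a(2) that by simp
      qed
      moreover have "c \<otimes> inv c \<in> P" using total[of c c] insert.prems by auto
      ultimately show ?thesis by auto
    qed
  qed
  from this[of S] S s obtain a where a: "a \<in> S" "\<forall>b\<in>S. a \<otimes> inv b \<in> P" by blast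
  have "a \<notin> torsion"
  proof
    assume "a \<in> torsion"
    then have "inv a \<in> P" using torsion_inv PT by auto
    moreover have "a \<otimes> inv s \<in> P" using a s by auto
    ultimately have "(a \<otimes> inv s) \<otimes> inv a \<in> P" using Pm by blast
    moreover have "(a \<otimes> inv s) \<otimes> inv a = inv s"
    proof -
      have "a \<in> carrier G" "s \<in> carrier G" using a s S by auto
      then show ?thesis by (simp add: m_comm inv_solve_left')
    qed
    ultimately show False using Pi[OF P(3)] s by simp
  qed
  with a P(1) show ?thesis by blast
qed

text \<open>Adjoining to a finite subgroup \<open>F\<close> an element \<open>s\<close> with
  \<open>s [^] n = \<one>\<close> yields at most \<open>n\<close> translates of \<open>F\<close>,
  because exponents of \<open>s\<close> reduce modulo \<open>n\<close>.\<close>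

lemma finite_subgroup_of_torsion:
  assumes "finite S" "S \<subseteq> torsion"
  shows "\<exists>F. subgroup F G \<and> finite F \<and> S \<subseteq> F"
  using assms
proof (induction S rule: finite_induct)
  case empty
  show ?case by (intro exI[of _ "{\<one>}"]) (simp add: triv_subgroup)
next
  case (insert s S)
  then obtain F where F: "subgroup F G" "finite F" "S \<subseteq> F" by auto
  have s: "s \<in> carrier G" "s \<in> torsion" using insert.prems torsion_subset by auto
  then obtain n :: nat where n: "n > 0" "s [^] n = \<one>" by (auto simp: torsion_def)
  have mod: "s [^] (k mod n) = s [^] k" for k :: nat
  proof -
    have "s [^] k = s [^] (n * (k div n) + k mod n)" by simp
    also have "\<dots> = (s [^] n) [^] (k div n) \<otimes> s [^] (k mod n)"
      using s by (simp add: nat_pow_pow nat_pow_mult)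
    finally show ?thesis using n s by simp
  qed
  define F' where "F' = (\<lambda>(f, k). f \<otimes> s [^] (k::nat)) ` (F \<times> {..<n})"
  have in_F': "f \<otimes> s [^] (k::nat) \<in> F'" if "f \<in> F" for f k
    unfolding F'_def using that n mod[of k]
    by (intro image_eqI[of _ _ "(f, k mod n)"]) auto
  have FG: "F \<subseteq> carrier G" using F(1) by (rule subgroup.subset)
  have "subgroup F' G"
  proof (rule subgroupI)
    show "F' \<subseteq> carrier G" using FG s by (auto simp: F'_def)
    show "F' \<noteq> {}" using in_F'[of \<one> 0] subgroup.one_closed[OF F(1)] by blast
  next
    fix g assume "g \<in> F'"
    then obtain f k where g: "f \<in> F" "k < n" "g = f \<otimes> s [^] k" by (auto simp: F'_def)
    have "s [^] (n - k) \<otimes> s [^] k = \<one>" using g s n by (simp add: nat_pow_mult)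
    then have "inv (s [^] k) = s [^] (n - k)" using s by (metis inv_equality nat_pow_closed)
    then have "inv g = inv f \<otimes> s [^] (n - k)" using g FG s by (auto simp: inv_mult)
    then show "inv g \<in> F'" using in_F' subgroup.m_inv_closed[OF F(1)] g by simp
  next
    fix g h assume "g \<in> F'" "h \<in> F'"
    from \<open>g \<in> F'\<close> obtain f k where g: "f \<in> F" "k < n" "g = f \<otimes> s [^] k"
      by (auto simp: F'_def)
    from \<open>h \<in> F'\<close> obtain f' k' where h: "f' \<in> F" "k' < n" "h = f' \<otimes> s [^] k'"
      by (auto simp: F'_def)
    have "f \<in> carrier G" "f' \<in> carrier G" using FG g h by auto
    then have "g \<otimes> h = (f \<otimes> f') \<otimes> s [^] (k + k')"
      using s g h by (simp add: m_ac flip: nat_pow_mult)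
    then show "g \<otimes> h \<in> F'" using in_F' subgroup.m_closed[OF F(1)] g h by simp
  qed
  moreover have "finite F'" using F by (simp add: F'_def)
  moreover have "S \<subseteq> F'"
  proof
    fix f assume "f \<in> S"
    then show "f \<in> F'" using in_F'[of f 0] F(3) FG by (simp add: subset_iff)
  qed
  moreover have "s \<in> F'"
    using in_F'[of \<one> 1] subgroup.one_closed[OF F(1)] s by simp
  ultimately show ?case by blast
qed

end

subsection \<open>Graded Lie algebras\<close>

context lie_setting
begin

text \<open>Otherwise every initial segment of the sequence would be independent, eventually
  outnumbering a finite spanning set of \<open>W\<close>.\<close>

lemma fin_dim_subspace_independent_seq:
  assumes "fin_dim_subspace W" "\<And>n. u n \<in> W"
  shows "\<exists>n::nat. u n \<in> span (u ` {..<n})"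
proof (rule ccontr)
  assume *: "\<nexists>n. u n \<in> span (u ` {..<n})"
  have ind: "independent (u ` {..<n}) \<and> card (u ` {..<n}) = n" for n
  proof (induction n)
    case (Suc n)
    have "u n \<notin> span (u ` {..<n})" using * by blast
    then have "u n \<notin> u ` {..<n}" by (metis span_base)
    have "independent (insert (u n) (u ` {..<n}))"
      using independent_insertI[OF \<open>u n \<notin> span (u ` {..<n})\<close>] Suc by blast
    moreover have "u ` {..<Suc n} = insert (u n) (u ` {..<n})" by (simp add: lessThan_Suc)
    moreover have "card (insert (u n) (u ` {..<n})) = Suc n"
      using Suc \<open>u n \<notin> u ` {..<n}\<close> by simp
    ultimately show ?case by simp
  qed (simp add: independent_empty)
  obtain B where B: "finite B" "W = span B" using assms(1) by (auto simp: fin_dim_subspace_def)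
  have "card (u ` {..<Suc (card B)}) \<le> card B"
    using independent_span_bound[OF B(1), of "u ` {..<Suc (card B)}"] ind assms(2) B(2) by blast
  then show False using ind[of "Suc (card B)"] by simp
qed

lemma fin_dim_subspace_span:
  assumes "finite B" "S \<subseteq> span B"
  shows "fin_dim_subspace (span S)"
proof -
  obtain C where C: "C \<subseteq> S" "independent C" "S \<subseteq> span C"
    by (rule maximal_independent_subset)
  then have "finite C" using independent_span_bound[OF assms(1) C(2)] assms(2) by auto
  moreover have "span S = span C"
    using C span_mono[of C S] span_minimal[of S "span C"] by auto
  ultimately show ?thesis by (auto simp: fin_dim_subspace_def)
qed

end

section \<open>Homogeneous components and supports in a graded Lie algebra\<close>

locale graded_lie = lie_setting scale + comm_group G
  for scale :: "'k::field \<Rightarrow> 'v::ab_group_add \<Rightarrow> 'v" (infixr \<open>*s\<close> 75)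
    and G :: "'g monoid" (structure) +
  fixes V :: "'v set" and br :: "'v \<Rightarrow> 'v \<Rightarrow> 'v" and D :: "'g \<Rightarrow> 'v set"
  assumes lie: "lie_algebra V br"
    and decomp: "direct_sum_decomp (carrier G) D V"
    and graded: "\<And>a b x y. a \<in> carrier G \<Longrightarrow> b \<in> carrier G \<Longrightarrow> x \<in> D a \<Longrightarrow> y \<in> D b \<Longrightarrow>
      br x y \<in> D (a \<otimes> b)"
begin

lemma V_subspace: "subspace V"
  and br_closed: "x \<in> V \<Longrightarrow> y \<in> V \<Longrightarrow> br x y \<in> V"
  and br_add_left: "x \<in> V \<Longrightarrow> y \<in> V \<Longrightarrow> z \<in> V \<Longrightarrow> br (x + y) z = br x z + br y z"
  and br_add_right: "x \<in> V \<Longrightarrow> y \<in> V \<Longrightarrow> z \<in> V \<Longrightarrow> br z (x + y) = br z x + br z y"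
  and br_scale_right: "x \<in> V \<Longrightarrow> y \<in> V \<Longrightarrow> br x (c *s y) = c *s br x y"
  using lie by (auto simp: lie_algebra_def)

lemmas V_zero = subspace_0[OF V_subspace]
  and V_add = subspace_add[OF V_subspace]
  and V_diff = subspace_diff[OF V_subspace]
  and V_scale = subspace_scale[OF V_subspace]
  and V_sum = subspace_sum[OF V_subspace]

lemma br_zero_right [simp]: "x \<in> V \<Longrightarrow> br x 0 = 0"
  using br_scale_right[of x 0 0] V_zero by simp

lemma br_zero_left [simp]: "x \<in> V \<Longrightarrow> br 0 x = 0"
  using br_add_left[of 0 0 x] V_zero by simp

lemma D_subspace: "a \<in> carrier G \<Longrightarrow> subspace (D a)"
  and D_subset: "a \<in> carrier G \<Longrightarrow> D a \<subseteq> V"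
  using decomp by (auto simp: direct_sum_decomp_def)

definition components :: "'v \<Rightarrow> ('g \<Rightarrow> 'v) \<Rightarrow> bool" where
  "components v f \<longleftrightarrow> (\<forall>a\<in>carrier G. f a \<in> D a) \<and> (\<forall>a. a \<notin> carrier G \<longrightarrow> f a = 0) \<and>
    finite {a. f a \<noteq> 0} \<and> v = (\<Sum>a | f a \<noteq> 0. f a)"

lemma components_unique: "v \<in> V \<Longrightarrow> \<exists>!f. components v f"
  using decomp by (simp add: direct_sum_decomp_def components_def)

text \<open>The description is meaningful only for \<open>v\<close> in \<open>V\<close>, where the
  decomposition exists and is unique; hence the membership conditions throughout.\<close>

definition cmp :: "'v \<Rightarrow> 'g \<Rightarrow> 'v" where
  "cmp v = (THE f. components v f)"

definition supp :: "'v \<Rightarrow> 'g set" where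
  "supp v = {a. cmp v a \<noteq> 0}"

lemma components_cmp: "v \<in> V \<Longrightarrow> components v (cmp v)"
  unfolding cmp_def using theI'[OF components_unique] by blast

lemma cmp_eqI: "v \<in> V \<Longrightarrow> components v f \<Longrightarrow> cmp v = f"
  using components_unique components_cmp by blast

lemma cmp_in_D: "v \<in> V \<Longrightarrow> a \<in> carrier G \<Longrightarrow> cmp v a \<in> D a"
  and supp_subset: "v \<in> V \<Longrightarrow> supp v \<subseteq> carrier G"
  and finite_supp: "v \<in> V \<Longrightarrow> finite (supp v)"
  and sum_cmp: "v \<in> V \<Longrightarrow> (\<Sum>a\<in>supp v. cmp v a) = v"
  using components_cmp[of v] by (auto simp: components_def supp_def)

lemma cmp_in_V: "v \<in> V \<Longrightarrow> cmp v a \<in> V"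
  using cmp_in_D[of v a] D_subset[of a] supp_subset[of v] V_zero
  by (cases "a \<in> carrier G") (auto simp: supp_def subset_iff, metis)

lemma components_sum:
  assumes "finite A" "A \<subseteq> carrier G" "\<And>a. a \<in> A \<Longrightarrow> f a \<in> D a"
  shows "components (\<Sum>a\<in>A. f a) (\<lambda>a. if a \<in> A then f a else 0)"
  unfolding components_def
proof (intro conjI ballI allI impI)
  show "finite {a. (if a \<in> A then f a else 0) \<noteq> 0}"
    by (rule finite_subset[OF _ assms(1)]) auto
  have "(\<Sum>a\<in>A. f a) = (\<Sum>a\<in>A. if a \<in> A then f a else 0)" by (intro sum.cong) auto
  also have "\<dots> = (\<Sum>a | (if a \<in> A then f a else 0) \<noteq> 0. if a \<in> A then f a else 0)"
    by (intro sum.mono_neutral_right assms(1)) auto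
  finally show "(\<Sum>a\<in>A. f a) = (\<Sum>a | (if a \<in> A then f a else 0) \<noteq> 0. if a \<in> A then f a else 0)" .
qed (use assms D_subspace subspace_0 in auto)

lemma cmp_sum:
  assumes "finite A" "A \<subseteq> carrier G" "\<And>a. a \<in> A \<Longrightarrow> f a \<in> D a"
  shows "cmp (\<Sum>a\<in>A. f a) = (\<lambda>a. if a \<in> A then f a else 0)"
proof (rule cmp_eqI)
  show "(\<Sum>a\<in>A. f a) \<in> V" using assms D_subset by (intro V_sum) blast
qed (rule components_sum[OF assms])

lemma cmp_add: 
  assumes "u \<in> V" "v \<in> V"
  shows "cmp (u + v) a = cmp u a + cmp v a"
proof -
  let ?A = "supp u \<union> supp v"
  have *: "(\<Sum>a\<in>?A. cmp w a) = w" if "w \<in> V" "supp w \<subseteq> ?A" for w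
  proof -
    have "(\<Sum>a\<in>?A. cmp w a) = (\<Sum>a\<in>supp w. cmp w a)"
      using that assms finite_supp by (intro sum.mono_neutral_right) (auto simp: supp_def)
    then show ?thesis using that sum_cmp by simp
  qed
  have "cmp (u + v) = cmp (\<Sum>a\<in>?A. cmp u a + cmp v a)"
    using *[of u] *[of v] assms by (simp add: sum.distrib)
  also have "\<dots> = (\<lambda>a. if a \<in> ?A then cmp u a + cmp v a else 0)"
  proof (rule cmp_sum)
    show "finite ?A" "?A \<subseteq> carrier G" using assms finite_supp supp_subset by auto
    show "cmp u a + cmp v a \<in> D a" if "a \<in> ?A" for a
    proof -
      have "a \<in> carrier G" using that supp_subset assms by blast
      then show ?thesis using assms by (intro subspace_add[OF D_subspace] cmp_in_D)
    qed
  qed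
  finally show ?thesis by (auto simp: supp_def)
qed

lemma supp_add: "u \<in> V \<Longrightarrow> v \<in> V \<Longrightarrow> supp (u + v) \<subseteq> supp u \<union> supp v"
  by (auto simp: supp_def cmp_add)

lemma cmp_scale:
  assumes "v \<in> V"
  shows "cmp (c *s v) a = c *s cmp v a"
proof -
  have "cmp (c *s v) = cmp (\<Sum>a\<in>supp v. c *s cmp v a)"
    using assms by (simp add: sum_cmp flip: scale_sum_right)
  also have "\<dots> = (\<lambda>a. if a \<in> supp v then c *s cmp v a else 0)"
    using assms supp_subset[OF assms]
    by (intro cmp_sum subspace_scale[OF D_subspace] cmp_in_D) (auto simp: finite_supp)
  finally show ?thesis by (simp add: supp_def)
qed

lemma supp_eq_empty: "v \<in> V \<Longrightarrow> supp v = {} \<longleftrightarrow> v = 0"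
  using sum_cmp[of v] cmp_add[of 0 0] V_zero by (auto simp: supp_def)

lemma supp_zero [simp]: "supp 0 = {}"
  using supp_eq_empty V_zero by blast

lemma supp_sum:
  assumes "\<And>a. a \<in> A \<Longrightarrow> f a \<in> V" "\<And>a. a \<in> A \<Longrightarrow> supp (f a) \<subseteq> K"
  shows "supp (\<Sum>a\<in>A. f a) \<subseteq> K"
  using assms
proof (induction A rule: infinite_finite_induct)
  case (insert a A)
  have "supp (f a + sum f A) \<subseteq> supp (f a) \<union> supp (sum f A)"
    using insert.prems by (intro supp_add V_sum) auto
  also have "\<dots> \<subseteq> K" using insert by simp
  finally show ?case using insert by simp
qed auto

lemma cmp_homogeneous:
  assumes "a \<in> carrier G" "v \<in> D a"
  shows "cmp v = (\<lambda>b. if b = a then v else 0)"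
  using cmp_sum[of "{a}" "\<lambda>_. v"] assms by auto

lemma supp_homogeneous: "a \<in> carrier G \<Longrightarrow> v \<in> D a \<Longrightarrow> supp v \<subseteq> {a}"
  by (auto simp: supp_def cmp_homogeneous split: if_splits)

lemma br_sum_left:
  assumes "finite A" "\<And>a. a \<in> A \<Longrightarrow> f a \<in> V" "y \<in> V"
  shows "br (\<Sum>a\<in>A. f a) y = (\<Sum>a\<in>A. br (f a) y)"
  using assms by (induction A rule: finite_induct) (auto simp: br_add_left V_sum)

lemma br_sum_right:
  assumes "finite A" "\<And>a. a \<in> A \<Longrightarrow> f a \<in> V" "y \<in> V"
  shows "br y (\<Sum>a\<in>A. f a) = (\<Sum>a\<in>A. br y (f a))"
  using assms by (induction A rule: finite_induct) (auto simp: br_add_right V_sum)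

lemma supp_br:
  assumes "x \<in> V" "y \<in> V"
  shows "supp (br x y) \<subseteq> {a \<otimes> b | a b. a \<in> supp x \<and> b \<in> supp y}"
proof -
  have "br x y = br (\<Sum>a\<in>supp x. cmp x a) (\<Sum>b\<in>supp y. cmp y b)"
    using assms by (simp add: sum_cmp)
  also have "\<dots> = (\<Sum>a\<in>supp x. br (cmp x a) (\<Sum>b\<in>supp y. cmp y b))"
    using assms by (intro br_sum_left finite_supp V_sum cmp_in_V)
  also have "\<dots> = (\<Sum>a\<in>supp x. \<Sum>b\<in>supp y. br (cmp x a) (cmp y b))"
    using assms by (intro sum.cong refl br_sum_right finite_supp cmp_in_V)
  finally have eq: "br x y = (\<Sum>a\<in>supp x. \<Sum>b\<in>supp y. br (cmp x a) (cmp y b))" .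
  have "supp (br (cmp x a) (cmp y b)) \<subseteq> {a \<otimes> b}" if "a \<in> supp x" "b \<in> supp y" for a b
    using that assms supp_subset[of x] supp_subset[of y]
    by (intro supp_homogeneous graded cmp_in_D m_closed) auto
  then have "supp (br (cmp x a) (cmp y b)) \<subseteq> {a \<otimes> b | a b. a \<in> supp x \<and> b \<in> supp y}"
    if "a \<in> supp x" "b \<in> supp y" for a b
    using that by blast
  then show ?thesis unfolding eq
    using assms by (intro supp_sum V_sum br_closed cmp_in_V)
qed

definition part :: "'g set \<Rightarrow> 'v \<Rightarrow> 'v" where
  "part K v = (\<Sum>a\<in>supp v \<inter> K. cmp v a)"

lemma
  assumes "v \<in> V"
  shows part_in_V: "part K v \<in> V"
    and supp_part: "supp (part K v) = supp v \<inter> K"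
    and supp_diff_part: "supp (v - part K v) = supp v - K"
proof -
  show 1: "part K v \<in> V" unfolding part_def using assms by (intro V_sum cmp_in_V)
  have 2: "cmp (part K v) = (\<lambda>a. if a \<in> supp v \<inter> K then cmp v a else 0)"
    unfolding part_def using assms supp_subset[OF assms]
    by (intro cmp_sum cmp_in_D) (auto simp: finite_supp)
  then show "supp (part K v) = supp v \<inter> K" by (auto simp: supp_def)
  have "cmp v a = cmp (v - part K v) a + cmp (part K v) a" for a
    using cmp_add[of "v - part K v" "part K v" a] 1 V_diff[OF assms 1] by simp
  then have "cmp (v - part K v) a = (if a \<in> supp v \<inter> K then 0 else cmp v a)" for a
    using fun_cong[OF 2, of a] by (metis add_cancel_right_left add_0_right)
  then show "supp (v - part K v) = supp v - K" by (auto simp: supp_def)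
qed

section \<open>Iterated brackets and local ad-nilpotency\<close>

lemma funpow_br_closed: "x \<in> V \<Longrightarrow> y \<in> V \<Longrightarrow> (br x ^^ n) y \<in> V"
  by (induction n) (auto simp: br_closed)

lemma funpow_br_zero: "x \<in> V \<Longrightarrow> (br x ^^ n) 0 = 0"
  by (induction n) auto

lemma funpow_br_add:
  "x \<in> V \<Longrightarrow> y \<in> V \<Longrightarrow> z \<in> V \<Longrightarrow> (br x ^^ n) (y + z) = (br x ^^ n) y + (br x ^^ n) z"
  by (induction n) (auto simp: br_add_right funpow_br_closed)

text \<open>The exponent may depend on \<open>y\<close>, so the exponents of its finitely many
  components are simply added.\<close>

lemma ad_nilpotent_if_homogeneous:
  assumes x: "x \<in> V" and hom: "\<And>b y. b \<in> carrier G \<Longrightarrow> y \<in> D b \<Longrightarrow> \<exists>n. (br x ^^ n) y = 0"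
    and y: "y \<in> V"
  shows "\<exists>n. (br x ^^ n) y = 0"
proof -
  have "\<exists>n. (br x ^^ n) (\<Sum>b\<in>A. cmp y b) = 0" if "finite A" "A \<subseteq> supp y" for A
    using that
  proof (induction A rule: finite_induct)
    case empty
    then show ?case by (auto intro: exI[of _ 0])
  next
    case (insert b A)
    then obtain m where m: "(br x ^^ m) (\<Sum>b\<in>A. cmp y b) = 0" by auto
    have b: "b \<in> carrier G" using insert.prems supp_subset y by auto
    then obtain n where n: "(br x ^^ n) (cmp y b) = 0" using hom cmp_in_D[OF y] by blast
    have "(br x ^^ (m + n)) (cmp y b) = 0"
      using n x by (simp add: funpow_add funpow_br_zero)
    moreover have "(br x ^^ (n + m)) (\<Sum>b\<in>A. cmp y b) = 0"
      unfolding funpow_add using m x by (simp add: funpow_br_zero)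
    ultimately have "(br x ^^ (m + n)) (cmp y b + (\<Sum>b\<in>A. cmp y b)) = 0"
      using x y by (simp add: funpow_br_add cmp_in_V V_sum add.commute)
    then show ?case using insert by auto
  qed
  from this[of "supp y"] y show ?thesis by (auto simp: finite_supp sum_cmp)
qed

lemma finite_supp_span:
  assumes "fin_dim_subspace W" "W \<subseteq> V"
  shows "\<exists>E. finite E \<and> (\<forall>w\<in>W. supp w \<subseteq> E)"
proof -
  obtain B where B: "finite B" "W = span B" using assms by (auto simp: fin_dim_subspace_def)
  then have BV: "B \<subseteq> V" using assms span_superset by blast
  have "w \<in> V \<and> supp w \<subseteq> (\<Union>b\<in>B. supp b)" if "w \<in> span B" for w
    using that
  proof (induction rule: span_induct_alt)
    case (step c b w)
    have b: "b \<in> V" using step BV by auto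
    have "supp (c *s b) \<subseteq> supp b" using b by (auto simp: supp_def cmp_scale)
    moreover have "supp (c *s b + w) \<subseteq> supp (c *s b) \<union> supp w"
      using b step(2) by (intro supp_add V_scale) auto
    ultimately show ?case using step b by (auto simp: V_add V_scale)
  qed (auto simp: V_zero)
  moreover have "finite (\<Union>b\<in>B. supp b)" using B BV finite_supp by auto
  ultimately show ?thesis using B by blast
qed

text \<open>
  The part of an ad-locally finite element in extremal non-torsion degree strictly shifts the
  grading, so it is ad-nilpotent.
\<close>

lemma extremal_part_ad_nilpotent:
  assumes x: "x \<in> V" and lf: "ad_locally_finite V br x" and tors: "\<not> supp x \<subseteq> torsion"
  shows "\<exists>u\<in>V. supp (x - u) \<subset> supp x \<and> (\<forall>y\<in>V. \<exists>n. (br u ^^ n) y = 0)"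
proof -
  obtain s where s: "s \<in> supp x" "s \<notin> torsion" using tors by auto
  obtain P a where P: "pure_cone P" and a: "a \<in> supp x" "a \<notin> torsion"
    and ab: "\<And>b. b \<in> supp x \<Longrightarrow> a \<otimes> inv b \<in> P"
    using ex_extremal[OF finite_supp supp_subset s] x by blast
  have PG: "P \<subseteq> carrier G" and Pm: "\<And>g h. g \<in> P \<Longrightarrow> h \<in> P \<Longrightarrow> g \<otimes> h \<in> P"
    and Pi: "\<And>g. g \<in> P \<Longrightarrow> inv g \<in> P \<Longrightarrow> g \<in> torsion" and PT: "torsion \<subseteq> P"
    using P unfolding pure_cone_def by blast+
  have aG: "a \<in> carrier G" using a x supp_subset by auto
  \<comment> \<open>The elements of \<open>P - torsion\<close> are the strictly positive ones:
    nonnegative plus strictly positive is strictly positive.\<close>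
  have PN: "p \<otimes> q \<in> P - torsion" if "p \<in> P" "q \<in> P - torsion" for p q
  proof -
    have "p \<otimes> q \<notin> torsion"
    proof
      assume "p \<otimes> q \<in> torsion"
      then have "p \<otimes> inv (p \<otimes> q) \<in> P" using torsion_inv PT Pm that by auto
      moreover have "p \<otimes> inv (p \<otimes> q) = inv q"
      proof -
        have "p \<in> carrier G" "q \<in> carrier G" using that PG by auto
        then show ?thesis by (simp add: inv_mult flip: m_assoc)
      qed
      ultimately show False using Pi[of q] that by auto
    qed
    then show ?thesis using Pm that by auto
  qed
  \<comment> \<open>\<open>K\<close> consists of the degrees equal to \<open>a\<close> modulo
    torsion, so \<open>u\<close> is the whole top layer of \<open>x\<close>, not just one
    component.\<close>
  define K where "K = {g \<in> carrier G. a \<otimes> inv g \<in> torsion}"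
  define u where "u = part K x"
  have uV: "u \<in> V" unfolding u_def using x by (rule part_in_V)
  have su: "supp u = supp x \<inter> K" and sxu: "supp (x - u) = supp x - K"
    unfolding u_def using x by (auto simp: supp_part supp_diff_part)
  have aK: "a \<in> K" using aG one_torsion by (simp add: K_def)
  have nil: "\<exists>n. (br u ^^ n) y = 0" if b: "b \<in> carrier G" and y: "y \<in> D b" for b y
  proof -
    have yV: "y \<in> V" using b y D_subset by auto
    \<comment> \<open>\<open>Q n\<close> is the layer of \<open>a [^] n \<otimes> b\<close> modulo
      torsion; \<open>R n\<close> consists of the degrees strictly below that layer.\<close>
    define Q where "Q n = {g \<in> carrier G. a [^] n \<otimes> b \<otimes> inv g \<in> torsion}" for n :: nat
    define R where "R n = {g \<in> carrier G. a [^] n \<otimes> b \<otimes> inv g \<in> P - torsion}" for n :: nat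
    have shift: "a [^] Suc n \<otimes> b \<otimes> inv (g \<otimes> h) = (a \<otimes> inv g) \<otimes> (a [^] n \<otimes> b \<otimes> inv h)"
      if "g \<in> carrier G" "h \<in> carrier G" for g h and n :: nat
      using that aG b by (simp add: inv_mult m_ac)
    have Qn: "supp ((br u ^^ n) y) \<subseteq> Q n" for n
    proof (induction n)
      case 0
      then show ?case using supp_homogeneous[OF b y] b one_torsion by (auto simp: Q_def)
    next
      case (Suc n)
      have "g \<otimes> h \<in> Q (Suc n)" if "g \<in> supp u" "h \<in> supp ((br u ^^ n) y)" for g h
      proof -
        have gh: "g \<in> K" "h \<in> Q n" using that su Suc by auto
        then have "(a \<otimes> inv g) \<otimes> (a [^] n \<otimes> b \<otimes> inv h) \<in> torsion"
          using torsion_mult[of "a \<otimes> inv g" "a [^] n \<otimes> b \<otimes> inv h"]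
          by (auto simp: K_def Q_def)
        then show ?thesis
          unfolding Q_def using gh shift[of g h n] by (auto simp: K_def Q_def)
      qed
      then show ?case using supp_br[OF uV funpow_br_closed[OF uV yV, of n]] by auto
    qed
    \<comment> \<open>When \<open>x\<close> is split as \<open>u\<close> plus \<open>x - u\<close>,
      the remainder \<open>r n\<close> gathers the terms of the iterate with at least one factor
      \<open>x - u\<close>. Each such factor pushes the degree strictly below the layer
      \<open>Q n\<close>.\<close>
    define r where "r n = (br x ^^ n) y - (br u ^^ n) y" for n
    have rV: "r n \<in> V" for n
      unfolding r_def using x uV yV by (intro V_diff funpow_br_closed)
    have r_Suc: "r (Suc n) = br x (r n) + br (x - u) ((br u ^^ n) y)" for n
    proof -
      have w: "(br u ^^ n) y \<in> V" using uV yV by (rule funpow_br_closed)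
      have "br x ((br x ^^ n) y) = br x (r n) + br x ((br u ^^ n) y)"
        using br_add_right[OF rV w x, of n] by (simp add: r_def)
      moreover have "br x ((br u ^^ n) y) = br (x - u) ((br u ^^ n) y) + br u ((br u ^^ n) y)"
        using br_add_left[OF V_diff[OF x uV] uV w] by simp
      ultimately show ?thesis by (simp add: r_def)
    qed
    have Rn: "supp (r n) \<subseteq> R n" for n
    proof (induction n)
      case 0
      then show ?case by (simp add: r_def)
    next
      case (Suc n)
      have 1: "g \<otimes> h \<in> R (Suc n)" if "g \<in> supp x" "h \<in> supp (r n)" for g h
      proof -
        have gh: "g \<in> carrier G" "h \<in> R n" using that supp_subset[OF x] Suc by auto
        then have "(a \<otimes> inv g) \<otimes> (a [^] n \<otimes> b \<otimes> inv h) \<in> P - torsion"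
          using ab that by (intro PN[of "a \<otimes> inv g"]) (auto simp: R_def)
        then show ?thesis
          unfolding R_def using gh shift[of g h n] by (auto simp: R_def)
      qed
      have 2: "g \<otimes> h \<in> R (Suc n)" if "g \<in> supp (x - u)" "h \<in> supp ((br u ^^ n) y)" for g h
      proof -
        have gh: "g \<in> carrier G" "g \<notin> K" "h \<in> Q n" and gx: "g \<in> supp x"
          using that supp_subset[OF x] Qn[of n] sxu by auto
        then have "(a [^] n \<otimes> b \<otimes> inv h) \<otimes> (a \<otimes> inv g) \<in> P - torsion"
          using ab[OF gx] PT by (intro PN[of "a [^] n \<otimes> b \<otimes> inv h"]) (auto simp: Q_def K_def)
        moreover have "(a [^] n \<otimes> b \<otimes> inv h) \<otimes> (a \<otimes> inv g) = (a \<otimes> inv g) \<otimes> (a [^] n \<otimes> b \<otimes> inv h)"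
          using gh aG b by (intro m_comm) (auto simp: Q_def)
        ultimately show ?thesis
          unfolding R_def using gh shift[of g h n] by (auto simp: Q_def)
      qed
      have "supp (r (Suc n)) \<subseteq> supp (br x (r n)) \<union> supp (br (x - u) ((br u ^^ n) y))"
        unfolding r_Suc using x uV yV rV by (intro supp_add br_closed V_diff funpow_br_closed)
      also have "\<dots> \<subseteq> R (Suc n)"
        using supp_br[OF x rV[of n]] supp_br[OF V_diff[OF x uV] funpow_br_closed[OF uV yV, of n]] 1 2
        by auto
      finally show ?case .
    qed
    let ?W = "span {(br x ^^ i) y | i. True}"
    have "?W \<subseteq> V"
      by (intro span_minimal V_subspace) (use x yV funpow_br_closed in auto)
    moreover have "fin_dim_subspace ?W"
      using lf yV by (auto simp: ad_locally_finite_def)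
    ultimately obtain E where E: "finite E" "\<And>w. w \<in> ?W \<Longrightarrow> supp w \<subseteq> E"
      using finite_supp_span by metis
    \<comment> \<open>The layers are disjoint because \<open>a\<close> has infinite order modulo
      torsion.\<close>
    have Q_unique: "n = m" if "g \<in> Q n" "g \<in> Q m" for g m n
    proof -
      have le: "m = n" if "m \<le> n" "g \<in> Q n" "g \<in> Q m" for m n
      proof (rule ccontr)
        assume "m \<noteq> n"
        have g: "g \<in> carrier G" using that by (simp add: Q_def)
        have "a [^] n = a [^] (n - m) \<otimes> a [^] m"
          using that aG by (simp add: nat_pow_mult)
        then have "(a [^] n \<otimes> b \<otimes> inv g) = a [^] (n - m) \<otimes> (a [^] m \<otimes> b \<otimes> inv g)"
          using g aG b by (simp add: m_assoc)
        then have "(a [^] n \<otimes> b \<otimes> inv g) \<otimes> inv (a [^] m \<otimes> b \<otimes> inv g) = a [^] (n - m)"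
          using g aG b by (simp add: inv_solve_right')
        moreover have "(a [^] n \<otimes> b \<otimes> inv g) \<otimes> inv (a [^] m \<otimes> b \<otimes> inv g) \<in> torsion"
          using that by (auto simp: Q_def intro!: torsion_mult[of "a [^] n \<otimes> b \<otimes> inv g"] torsion_inv[of "a [^] m \<otimes> b \<otimes> inv g"])
        ultimately show False
          using torsion_root[OF aG, of "n - m"] a(2) \<open>m \<noteq> n\<close> that(1) by simp
      qed
      show ?thesis using le[of m n] le[of n m] that by (cases "m \<le> n") auto
    qed
    \<comment> \<open>All iterates of \<open>br x\<close> on \<open>y\<close> have support in the
      finite set \<open>E\<close>, which therefore meets only finitely many layers.\<close>
    have "finite {n. \<exists>g\<in>E. g \<in> Q n}"
    proof -
      have "{n. \<exists>g\<in>E. g \<in> Q n} \<subseteq> (\<lambda>g. THE n. g \<in> Q n) ` E"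
        using Q_unique by (auto intro!: image_eqI the_equality[symmetric])
      then show ?thesis using E(1) by (meson finite_imageI finite_subset)
    qed
    then obtain n where n: "n \<notin> {n. \<exists>g\<in>E. g \<in> Q n}"
      using ex_new_if_finite infinite_UNIV_nat by blast
    \<comment> \<open>The remainder has no component in the layer \<open>Q n\<close>, so nothing can
      cancel there: a nonzero top part would force \<open>E\<close> to meet that layer.\<close>
    have "supp ((br u ^^ n) y) = {}"
    proof (rule ccontr)
      assume "supp ((br u ^^ n) y) \<noteq> {}"
      then obtain g where g: "g \<in> supp ((br u ^^ n) y)" by auto
      then have "g \<in> Q n" using Qn by auto
      then have "g \<notin> supp (r n)" using Rn[of n] by (auto simp: Q_def R_def)
      moreover have "cmp ((br x ^^ n) y) g = cmp (r n) g + cmp ((br u ^^ n) y) g"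
        using cmp_add[OF rV funpow_br_closed[OF uV yV], of n n g] by (simp add: r_def)
      ultimately have "g \<in> supp ((br x ^^ n) y)" using g by (simp add: supp_def)
      moreover have "(br x ^^ n) y \<in> ?W" by (rule span_base) auto
      ultimately show False using E(2) n \<open>g \<in> Q n\<close> by blast
    qed
    then show ?thesis using supp_eq_empty funpow_br_closed[OF uV yV] by blast
  qed
  have "supp (x - u) \<subset> supp x" using sxu a aK by auto
  moreover have "\<forall>y\<in>V. \<exists>n. (br u ^^ n) y = 0"
    using ad_nilpotent_if_homogeneous[OF uV] nil by blast
  ultimately show ?thesis using uV by blast
qed

section \<open>Elements supported in torsion degrees\<close>

lemma funpow_br_scale:
  "x \<in> V \<Longrightarrow> y \<in> V \<Longrightarrow> (br x ^^ n) (c *s y) = c *s (br x ^^ n) y"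
  by (induction n) (auto simp: br_scale_right funpow_br_closed)

text \<open>
  A finite sum of homogeneous components stable under \<open>br x\<close> and meeting \<open>v 0\<close> contains
  vectors on which \<open>br x\<close> is nilpotent of every order.
\<close>

lemma torsion_supp_no_jordan_chain:
  assumes x: "x \<in> V" "supp x \<subseteq> torsion"
    and fd: "\<And>a. a \<in> carrier G \<Longrightarrow> fin_dim_subspace (D a)"
    and v: "\<And>n. v n \<in> V" "v 0 \<noteq> 0" "br x (v 0) = 0"
      "\<And>n. br x (v (Suc n)) = c n *s v n" "\<And>n. c n \<noteq> 0"
  shows False
proof -
  obtain F where F: "subgroup F G" "finite F" "supp x \<subseteq> F"
    using finite_subgroup_of_torsion[OF finite_supp[OF x(1)] x(2)] by blast
  obtain g0 where g0: "g0 \<in> supp (v 0)" using v supp_eq_empty[of "v 0"] by auto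
  then have g0G: "g0 \<in> carrier G" using supp_subset v by auto
  \<comment> \<open>The coset of the finite group \<open>F\<close> through \<open>g0\<close>. As
    \<open>F\<close> contains all degrees of \<open>x\<close>, bracketing with \<open>x\<close>
    preserves both the degrees inside \<open>K\<close> and those outside.\<close>
  define K where "K = {g \<in> carrier G. g \<otimes> inv g0 \<in> F}"
  have "g0 \<in> K" using g0G subgroup.one_closed[OF F(1)] by (simp add: K_def)
  have "K \<subseteq> (\<lambda>f. f \<otimes> g0) ` F"
  proof
    fix g assume "g \<in> K"
    then have "g = (g \<otimes> inv g0) \<otimes> g0" "g \<otimes> inv g0 \<in> F"
      using g0G by (auto simp: K_def m_assoc)
    then show "g \<in> (\<lambda>f. f \<otimes> g0) ` F" by blast
  qed
  then have "finite K" using F(2) finite_surj by blast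
  have coset: "g \<otimes> h \<in> K \<longleftrightarrow> h \<in> K" if "g \<in> supp x" "h \<in> carrier G" for g h
  proof -
    have g: "g \<in> F" "g \<in> carrier G" using that F(3) x(2) torsion_subset by auto
    have 1: "(g \<otimes> h) \<otimes> inv g0 = g \<otimes> (h \<otimes> inv g0)" using g that g0G by (simp add: m_assoc)
    have 2: "h \<otimes> inv g0 = inv g \<otimes> ((g \<otimes> h) \<otimes> inv g0)"
      using g that g0G by (simp add: m_assoc inv_solve_left)
    show ?thesis
      using 1 2 g that subgroup.m_closed[OF F(1)] subgroup.m_inv_closed[OF F(1)]
      by (metis (no_types, lifting) K_def m_closed mem_Collect_eq)
  qed
  have supp_Suc: "\<exists>a\<in>supp x. \<exists>b\<in>supp ((br x ^^ n) w). b \<in> carrier G \<and> g = a \<otimes> b"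
    if "w \<in> V" "g \<in> supp ((br x ^^ Suc n) w)" for g w n
  proof -
    have "g \<in> supp (br x ((br x ^^ n) w))" using that by simp
    then show ?thesis
      using supp_br[OF x(1) funpow_br_closed[OF x(1) that(1), of n]]
        supp_subset[OF funpow_br_closed[OF x(1) that(1), of n]] by blast
  qed
  have in_K: "supp ((br x ^^ n) w) \<subseteq> K" if "w \<in> V" "supp w \<subseteq> K" for w n
  proof (induction n)
    case (Suc n)
    then show ?case using supp_Suc[OF that(1), of _ n] coset by blast
  qed (use that in simp)
  have off_K: "supp ((br x ^^ n) w) \<inter> K = {}" if "w \<in> V" "supp w \<inter> K = {}" for w n
  proof (induction n)
    case (Suc n)
    then show ?case using supp_Suc[OF that(1), of _ n] coset by blast
  qed (use that in simp)
  \<comment> \<open>Project the chain to the degrees in \<open>K\<close>. The projections lie in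
    finitely many finite-dimensional components, and the degree \<open>g0\<close> of
    \<open>v 0\<close> survives.\<close>
  define u where "u n = part K (v n)" for n
  have u: "u n \<in> V" "supp (u n) \<subseteq> K" and w: "v n - u n \<in> V" "supp (v n - u n) \<inter> K = {}" for n
    using v(1)[of n] by (auto simp: u_def part_in_V supp_part supp_diff_part V_diff)
  have split: "(br x ^^ m) (v n) = (br x ^^ m) (u n) + (br x ^^ m) (v n - u n)" for m n
    using funpow_br_add[OF x(1) u(1) w(1), of m n n] by simp
  have chain: "\<exists>d. d \<noteq> 0 \<and> (br x ^^ n) (v n) = d *s v 0" for n
  proof (induction n)
    case 0
    show ?case by (auto intro!: exI[of _ 1])
  next
    case (Suc n)
    then obtain d where "d \<noteq> 0" "(br x ^^ n) (v n) = d *s v 0" by auto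
    then have "(br x ^^ Suc n) (v (Suc n)) = (c n * d) *s v 0"
      unfolding funpow_Suc_right using v x by (simp add: funpow_br_scale)
    then show ?case using v(5)[of n] \<open>d \<noteq> 0\<close> by (metis mult_eq_0_iff)
  qed
  \<comment> \<open>The \<open>n\<close>-th iterate of \<open>v n\<close> is a nonzero multiple of
    \<open>v 0\<close>, which has a component in degree \<open>g0\<close>; the part off
    \<open>K\<close> cannot supply it.\<close>
  have nz: "(br x ^^ n) (u n) \<noteq> 0" for n
  proof
    assume "(br x ^^ n) (u n) = 0"
    then obtain d where "d \<noteq> 0" "(br x ^^ n) (v n - u n) = d *s v 0"
      using chain[of n] split[of n n] by auto
    then have "g0 \<in> supp ((br x ^^ n) (v n - u n))"
      using g0 v(1) by (simp add: supp_def cmp_scale)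
    then show False using off_K[OF w, of n n] \<open>g0 \<in> K\<close> by auto
  qed
  \<comment> \<open>The parts on and off \<open>K\<close> have disjoint supports and sum to zero, so
    each of them vanishes.\<close>
  have z: "(br x ^^ Suc n) (u n) = 0" for n
  proof -
    have "(br x ^^ Suc n) (v n) = 0"
      using chain[of n] x v by (auto simp: br_scale_right)
    then have 0: "(br x ^^ Suc n) (u n) + (br x ^^ Suc n) (v n - u n) = 0"
      using split[of "Suc n" n] by argo
    have sum_0: "cmp ((br x ^^ Suc n) (u n)) g + cmp ((br x ^^ Suc n) (v n - u n)) g = 0" for g
    proof -
      have "cmp (0 :: 'v) g = 0" using supp_zero by (simp add: supp_def)
      then show ?thesis
        using cmp_add[OF funpow_br_closed[OF x(1) u(1)] funpow_br_closed[OF x(1) w(1)], of "Suc n" n "Suc n" n g]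
        by (simp only: 0)
    qed
    have "g \<in> supp ((br x ^^ Suc n) (v n - u n))" if "g \<in> supp ((br x ^^ Suc n) (u n))" for g
      using sum_0[of g] that by (auto simp: supp_def simp del: funpow.simps)
    then have "supp ((br x ^^ Suc n) (u n)) = {}"
      using in_K[OF u, of "Suc n" n] off_K[OF w, of "Suc n" n] by blast
    then show ?thesis using supp_eq_empty funpow_br_closed[OF x(1) u(1)] by blast
  qed
  have "\<forall>a\<in>carrier G. \<exists>B. finite B \<and> D a = span B"
    using fd by (simp add: fin_dim_subspace_def)
  then obtain B where B: "\<And>a. a \<in> carrier G \<Longrightarrow> finite (B a) \<and> D a = span (B a)" by metis
  let ?W = "span (\<Union>a\<in>K. B a)"
  have "u n \<in> ?W" for n
    unfolding u_def part_def
  proof (intro span_sum)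
    fix a assume a: "a \<in> supp (v n) \<inter> K"
    then have "cmp (v n) a \<in> span (B a)"
      using cmp_in_D[OF v(1), of a n] B by (auto simp: K_def)
    then show "cmp (v n) a \<in> ?W"
      using span_mono[of "B a" "\<Union>a\<in>K. B a"] a by auto
  qed
  moreover have "fin_dim_subspace ?W"
    using \<open>finite K\<close> B by (auto simp: fin_dim_subspace_def K_def intro!: exI[of _ "\<Union>a\<in>K. B a"])
  \<comment> \<open>Finite dimension makes some \<open>u n\<close> a combination of its
    predecessors. Those are killed by the \<open>n\<close>-th iterate of \<open>br x\<close>,
    whereas \<open>u n\<close> is not.\<close>
  ultimately obtain n where n: "u n \<in> span (u ` {..<n})"
    using fin_dim_subspace_independent_seq by blast
  have "y \<in> V \<and> (br x ^^ n) y = 0" if "y \<in> span (u ` {..<n})" for y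
    using that
  proof (induction rule: span_induct_alt)
    case base
    then show ?case using x by (simp add: funpow_br_zero V_zero)
  next
    case (step d b y)
    then obtain m where m: "m < n" "b = u m" by auto
    then have "(br x ^^ n) b = (br x ^^ (n - Suc m)) ((br x ^^ Suc m) (u m))"
      by (metis Suc_leI comp_apply funpow_add le_add_diff_inverse2)
    then have "(br x ^^ n) b = 0" using z x by (simp add: funpow_br_zero del: funpow.simps)
    then show ?case
      using step m u x by (simp add: funpow_br_add funpow_br_scale V_add V_scale)
  qed
  then show False using n nz by blast
qed

end

subsection \<open>Supports in the basis\<close>

abbreviation (input) "lookup \<equiv> Poly_Mapping.lookup"
abbreviation (input) "keys \<equiv> Poly_Mapping.keys"

fun hv_idx :: "hv_index \<Rightarrow> complex" where
  "hv_idx (Lx \<alpha> i) = \<alpha>"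
| "hv_idx (Hx \<alpha> i) = \<alpha>"

lemma hv_keys_subspace: "hv.subspace {x. keys x \<subseteq> K}"
  unfolding hv.subspace_def by (auto simp: in_keys_iff lookup_add subset_iff) (metis add.right_neutral)

lemma hv_expand: "x = (\<Sum>k\<in>keys x. lookup x k *\<^sub>h hv_basis k)"
  by (rule poly_mapping_eqI) (auto simp: lookup_sum lookup_single when_def in_keys_iff
      if_distrib[of "(*) _"] cong: if_cong)

text \<open>Turns membership in \<open>HV\<close>, \<open>HV_H\<close> and the span of
  \<open>H 0 0\<close> into conditions on \<open>keys\<close>.\<close>

lemma span_hv_basis: "hv.span (hv_basis ` K) = {x. keys x \<subseteq> K}"
proof
  show "hv.span (hv_basis ` K) \<subseteq> {x. keys x \<subseteq> K}"
    by (rule hv.span_minimal[OF _ hv_keys_subspace]) auto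
  show "{x. keys x \<subseteq> K} \<subseteq> hv.span (hv_basis ` K)"
  proof
    fix x :: hv assume "x \<in> {x. keys x \<subseteq> K}"
    then show "x \<in> hv.span (hv_basis ` K)"
      by (subst hv_expand, intro hv.span_sum hv.span_scale hv.span_base) auto
  qed
qed

lemma HV_eq: "HV \<Gamma> = {x. \<forall>k\<in>keys x. hv_idx k \<in> \<Gamma>}"
proof -
  have "{L \<alpha> i |\<alpha> i. \<alpha> \<in> \<Gamma>} \<union> {H \<alpha> i |\<alpha> i. \<alpha> \<in> \<Gamma>} = hv_basis ` {k. hv_idx k \<in> \<Gamma>}"
    (is "?l = ?r")
  proof
    show "?l \<subseteq> ?r" by (force simp: L_def H_def)
    show "?r \<subseteq> ?l"
    proof
      fix x assume "x \<in> ?r"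
      then obtain k where k: "x = hv_basis k" "hv_idx k \<in> \<Gamma>" by auto
      then show "x \<in> ?l" by (cases k) (auto simp: L_def H_def)
    qed
  qed
  then show ?thesis by (auto simp: HV_def span_hv_basis)
qed

lemma HV_H_eq: "HV_H \<Gamma> = {x. \<forall>k\<in>keys x. \<exists>\<alpha> i. k = Hx \<alpha> i \<and> \<alpha> \<in> \<Gamma>}"
proof -
  have "{H \<alpha> i |\<alpha> i. \<alpha> \<in> \<Gamma>} = hv_basis ` {Hx \<alpha> i |\<alpha> i. \<alpha> \<in> \<Gamma>}"
    by (auto simp: H_def)
  then show ?thesis by (auto simp: HV_H_def span_hv_basis)
qed

lemma HV_subspace: "hv.subspace (HV \<Gamma>)"
  by (simp add: HV_def)

lemma HV_H_subset: "HV_H \<Gamma> \<subseteq> HV \<Gamma>"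
  by (fastforce simp: HV_eq HV_H_eq)

lemma L_in_HV: "\<alpha> \<in> \<Gamma> \<Longrightarrow> L \<alpha> i \<in> HV \<Gamma>" and H_in_HV: "\<alpha> \<in> \<Gamma> \<Longrightarrow> H \<alpha> i \<in> HV \<Gamma>"
  by (auto simp: HV_eq L_def H_def)

lemma keys_L [simp]: "keys (L \<alpha> i) = {Lx \<alpha> i}" and keys_H [simp]: "keys (H \<alpha> i) = {Hx \<alpha> i}"
  by (simp_all add: L_def H_def)

lemma L_ne_0 [simp]: "L \<alpha> i \<noteq> 0" and H_ne_0 [simp]: "H \<alpha> i \<noteq> 0"
  by (metis insert_not_empty keys_L keys_zero) (metis insert_not_empty keys_H keys_zero)

lemma span_singleton_H: "hv.span {H \<alpha> i} = {x. keys x \<subseteq> {Hx \<alpha> i}}"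
  using span_hv_basis[of "{Hx \<alpha> i}"] by (simp add: H_def)

lemma keys_scale_subset: "keys (c *\<^sub>h x) \<subseteq> keys x"
  by (auto simp: in_keys_iff)

lemma keys_hv_bracket: "keys (hv_bracket x y) \<subseteq> (\<Union>k\<in>keys x. \<Union>l\<in>keys y. keys (hv_basis_bracket k l))"
proof -
  have "hv_bracket x y \<in> {z. keys z \<subseteq> (\<Union>k\<in>keys x. \<Union>l\<in>keys y. keys (hv_basis_bracket k l))}"
    unfolding hv_bracket_def
  proof (intro hv.subspace_sum[OF hv_keys_subspace] hv.subspace_scale[OF hv_keys_subspace])
    fix k l assume "k \<in> keys x" "l \<in> keys y"
    then show "hv_basis_bracket k l \<in> {z. keys z \<subseteq> (\<Union>k\<in>keys x. \<Union>l\<in>keys y. keys (hv_basis_bracket k l))}"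
      by blast
  qed
  then show ?thesis by blast
qed

text \<open>For \<open>j = 0\<close> the derivative term has coefficient zero, so the truncated
  index is left out of the bound.\<close>

lemma keys_LH_bracket:
  "keys (hv_basis_bracket (Lx \<alpha> i) (Hx \<beta> j)) \<subseteq>
     {Hx (\<alpha> + \<beta>) (i + j)} \<union> (if j = 0 then {} else {Hx (\<alpha> + \<beta>) (i + j - 1)})"
  by (auto simp: in_keys_iff lookup_add H_def lookup_single when_def split: if_splits)

text \<open>On both families \<open>L 0 0\<close> acts as the derivation of x^\<beta> t^j in \<beta>
  and j; leaving the constructor \<open>c\<close> open lets one formula serve \<open>L\<close> and
  \<open>H\<close> alike.\<close>

lemma lookup_bracket_L00:
  assumes "c = Lx \<or> c = Hx"
  shows "lookup (hv_bracket (L 0 0) y) (c \<beta> j) =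
    \<beta> * lookup y (c \<beta> j) + of_nat (Suc j) * lookup y (c \<beta> (Suc j))"
proof -
  have basis: "lookup (hv_bracket (L 0 0) (hv_basis k)) (c \<beta> j) =
    \<beta> * lookup (hv_basis k) (c \<beta> j) + of_nat (Suc j) * lookup (hv_basis k) (c \<beta> (Suc j))" for k
  proof (cases k)
    case (Lx \<alpha> i)
    then show ?thesis
      unfolding L_def hv_bracket_basis using assms
      by (cases i) (auto simp: L_def lookup_add lookup_minus lookup_single when_def)
  next
    case (Hx \<alpha> i)
    then show ?thesis
      unfolding L_def hv_bracket_basis using assms
      by (cases i) (auto simp: H_def lookup_add lookup_minus lookup_single when_def)
  qed
  have "y \<in> hv.span (range hv_basis)" by (simp add: hv_span_basis)
  then show ?thesis
  proof (induction rule: hv.span_induct_alt)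
    case base
    then show ?case by simp
  next
    case (step a b y)
    then obtain k where "b = hv_basis k" by auto
    with step show ?case
      by (simp add: hv_bracket_add_right hv_bracket_scale_right lookup_add basis algebra_simps)
  qed
qed

subsection \<open>Leading terms\<close>

text \<open>Complex numbers are compared by real and then imaginary part. The sign \<open>s\<close>
  reverses the order on the group only; larger powers of t stay larger for either sign.\<close>

definition hv_key :: "real \<Rightarrow> complex \<Rightarrow> nat \<Rightarrow> real \<times> real \<times> nat" where
  "hv_key s \<alpha> i = (s * Re \<alpha>, s * Im \<alpha>, i)"

text \<open>Real and imaginary parts add, so equality of the sums excludes a strict inequality first
  in the real and then in the imaginary parts. Only the second indices are then left to
  compare.\<close>

lemma hv_key_add_eq:
  assumes "s = 1 \<or> s = -1" "hv_key s \<alpha>' i' \<le> hv_key s \<alpha> i" "hv_key s \<beta>' j' \<le> hv_key s \<beta> j"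
    "\<alpha>' + \<beta>' = \<alpha> + \<beta>"
  shows "\<alpha>' = \<alpha> \<and> \<beta>' = \<beta> \<and> i' \<le> i \<and> j' \<le> j"
proof -
  have "Re \<alpha>' + Re \<beta>' = Re \<alpha> + Re \<beta>" "Im \<alpha>' + Im \<beta>' = Im \<alpha> + Im \<beta>"
    using assms(4) by (metis plus_complex.simps)+
  then show ?thesis using assms(1-3) by (auto simp: hv_key_def complex_eq_iff)
qed

lemma hv_key_add_mono:
  assumes "hv_key s \<alpha>' i' \<le> hv_key s \<alpha> i" "hv_key s \<beta>' j' \<le> hv_key s \<beta> j"
  shows "hv_key s (\<alpha>' + \<beta>') (i' + j') \<le> hv_key s (\<alpha> + \<beta>) (i + j)"
  using assms by (auto simp: hv_key_def algebra_simps)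

lemma hv_key_mono: "i \<le> j \<Longrightarrow> hv_key s \<alpha> i \<le> hv_key s \<alpha> j"
  by (auto simp: hv_key_def)

text \<open>The leading exponent of f when \<open>x\<close> is written as f \<partial> + h; the part
  h is deliberately ignored.\<close>

definition L_lead :: "real \<Rightarrow> hv \<Rightarrow> complex \<Rightarrow> nat \<Rightarrow> bool" where
  "L_lead s x \<alpha> i \<longleftrightarrow> Lx \<alpha> i \<in> keys x \<and>
     (\<forall>\<beta> j. Lx \<beta> j \<in> keys x \<longrightarrow> hv_key s \<beta> j \<le> hv_key s \<alpha> i)"

text \<open>Says that \<open>y\<close> lies in the span of the \<open>H\<close> vectors and bounds
  its exponents from above, without asking that the bound be attained.\<close>

definition H_bounded :: "real \<Rightarrow> hv \<Rightarrow> complex \<Rightarrow> nat \<Rightarrow> bool" where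
  "H_bounded s y \<beta> j \<longleftrightarrow> (\<forall>k\<in>keys y. \<exists>\<gamma> m. k = Hx \<gamma> m \<and> hv_key s \<gamma> m \<le> hv_key s \<beta> j)"

lemma ex_L_lead:
  assumes "Lx \<alpha> i \<in> keys x"
  shows "\<exists>\<beta> j. L_lead s x \<beta> j"
proof -
  let ?A = "{(\<beta>, j). Lx \<beta> j \<in> keys x}"
  have "?A = (\<lambda>k. case k of Lx \<beta> j \<Rightarrow> (\<beta>, j) | Hx \<beta> j \<Rightarrow> (\<beta>, j)) ` {k \<in> keys x. \<exists>\<beta> j. k = Lx \<beta> j}"
    by (force split: hv_index.splits)
  then have "finite ?A" by simp
  then have fin: "finite ((\<lambda>(\<beta>, j). hv_key s \<beta> j) ` ?A)" by (rule finite_imageI)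
  then have "Max ((\<lambda>(\<beta>, j). hv_key s \<beta> j) ` ?A) \<in> (\<lambda>(\<beta>, j). hv_key s \<beta> j) ` ?A"
    using assms by (intro Max_in) auto
  then obtain \<beta> j where \<beta>: "Lx \<beta> j \<in> keys x" "hv_key s \<beta> j = Max ((\<lambda>(\<beta>, j). hv_key s \<beta> j) ` ?A)"
    by auto
  have "hv_key s \<gamma> m \<le> hv_key s \<beta> j" if "Lx \<gamma> m \<in> keys x" for \<gamma> m
    unfolding \<beta> using that by (intro Max_ge fin) force
  with \<beta>(1) show ?thesis unfolding L_lead_def by blast
qed

text \<open>The \<open>H\<close> terms of \<open>x\<close> commute with \<open>y\<close>. The
  \<open>L\<close> terms add exponents, and the derivative in t only lowers the second
  index.\<close>

lemma H_bounded_bracket: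
  assumes x: "L_lead s x \<alpha> i" and y: "H_bounded s y \<beta> j"
  shows "H_bounded s (hv_bracket x y) (\<alpha> + \<beta>) (i + j)"
  unfolding H_bounded_def
proof
  fix k assume "k \<in> keys (hv_bracket x y)"
  then obtain a b where ab: "a \<in> keys x" "b \<in> keys y" "k \<in> keys (hv_basis_bracket a b)"
    using keys_hv_bracket by blast
  then obtain \<beta>' j' where b: "b = Hx \<beta>' j'" "hv_key s \<beta>' j' \<le> hv_key s \<beta> j"
    using y by (auto simp: H_bounded_def)
  show "\<exists>\<gamma> m. k = Hx \<gamma> m \<and> hv_key s \<gamma> m \<le> hv_key s (\<alpha> + \<beta>) (i + j)"
  proof (cases a)
    case (Lx \<alpha>' i')
    then have "hv_key s \<alpha>' i' \<le> hv_key s \<alpha> i" using x ab by (auto simp: L_lead_def)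
    then have "hv_key s (\<alpha>' + \<beta>') (i' + j') \<le> hv_key s (\<alpha> + \<beta>) (i + j)"
      using b by (intro hv_key_add_mono)
    moreover have "hv_key s (\<alpha>' + \<beta>') (i' + j' - 1) \<le> hv_key s (\<alpha>' + \<beta>') (i' + j')"
      by (rule hv_key_mono) simp
    ultimately show ?thesis
      using ab(3) keys_LH_bracket[of \<alpha>' i' \<beta>' j'] unfolding Lx b
      by (auto split: if_splits intro: order_trans)
  qed (use ab b in simp)
qed

text \<open>Only the two leading terms can produce the top exponent, and the factor \<beta> comes
  from differentiating x^\<beta>. The derivative in t lands below the top.\<close>

lemma lookup_bracket_lead:
  assumes s: "s = 1 \<or> s = -1" and x: "L_lead s x \<alpha> i" and y: "H_bounded s y \<beta> j"
  shows "lookup (hv_bracket x y) (Hx (\<alpha> + \<beta>) (i + j)) = lookup x (Lx \<alpha> i) * lookup y (Hx \<beta> j) * \<beta>"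
proof -
  let ?B = "insert (Hx \<beta> j) (keys y)" and ?t = "Hx (\<alpha> + \<beta>) (i + j)"
  let ?v = "lookup x (Lx \<alpha> i) * lookup y (Hx \<beta> j) * \<beta>"
  have terms: "lookup x k * lookup y l * lookup (hv_basis_bracket k l) ?t =
      (if k = Lx \<alpha> i then if l = Hx \<beta> j then ?v else 0 else 0)"
    if k: "k \<in> keys x" and l: "l \<in> ?B" for k l
  proof -
    obtain \<beta>' j' where l': "l = Hx \<beta>' j'" "hv_key s \<beta>' j' \<le> hv_key s \<beta> j"
      using y l by (auto simp: H_bounded_def)
    show ?thesis
    proof (cases k)
      case (Lx \<alpha>' i')
      then have k': "hv_key s \<alpha>' i' \<le> hv_key s \<alpha> i" using x k by (auto simp: L_lead_def)
      have *: "lookup (hv_basis_bracket k l) ?t =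
        (if \<alpha>' + \<beta>' = \<alpha> + \<beta> \<and> i' + j' = i + j then \<beta>' else 0) +
        of_nat j' * (if \<alpha>' + \<beta>' = \<alpha> + \<beta> \<and> i' + j' - 1 = i + j then 1 else 0)"
        by (simp add: Lx l' lookup_add H_def lookup_single when_def)
      show ?thesis
      proof (cases "\<alpha>' + \<beta>' = \<alpha> + \<beta>")
        case True
        then have "\<alpha>' = \<alpha>" "\<beta>' = \<beta>" "i' \<le> i" "j' \<le> j"
          using hv_key_add_eq[OF s k' l'(2)] by auto
        \<comment> \<open>Truncated subtraction allows equality only when all indices are zero, and
          then the coefficient \<open>j'\<close> vanishes.\<close>
        moreover from this have "j' = 0 \<or> i' + j' - 1 \<noteq> i + j" by auto
        ultimately show ?thesis unfolding * by (auto simp: Lx l')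
      next
        case False
        then show ?thesis unfolding * by (auto simp: Lx l')
      qed
    qed (use l' in simp)
  qed
  have "lookup (hv_bracket x y) ?t =
    (\<Sum>k\<in>keys x. \<Sum>l\<in>?B. lookup x k * lookup y l * lookup (hv_basis_bracket k l) ?t)"
    by (subst hv_bracket_superset[of "keys x" x ?B y]) (auto simp: lookup_sum)
  also have "\<dots> = (\<Sum>k\<in>keys x. \<Sum>l\<in>?B. if k = Lx \<alpha> i then if l = Hx \<beta> j then ?v else 0 else 0)"
    by (intro sum.cong refl terms)
  also have "\<dots> = (\<Sum>k\<in>keys x. if k = Lx \<alpha> i then ?v else 0)"
    by (intro sum.cong refl) (auto simp: sum.delta)
  also have "\<dots> = ?v" using x by (simp add: sum.delta L_lead_def)
  finally show ?thesis .
qed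

text \<open>Each iteration multiplies the leading coefficient by that of \<open>x\<close> and by the
  current group degree; the hypothesis on \<beta> keeps the latter factor nonzero.\<close>

lemma ad_iterate_lead:
  assumes s: "s = 1 \<or> s = -1" and x: "L_lead s x \<alpha> i" and \<beta>: "\<And>n. \<beta> + of_nat n * \<alpha> \<noteq> 0"
  shows "H_bounded s ((hv_bracket x ^^ n) (H \<beta> 0)) (\<beta> + of_nat n * \<alpha>) (n * i) \<and>
    Hx (\<beta> + of_nat n * \<alpha>) (n * i) \<in> keys ((hv_bracket x ^^ n) (H \<beta> 0))"
proof (induction n)
  case 0
  show ?case by (auto simp: H_bounded_def)
next
  case (Suc n)
  have eq: "\<beta> + of_nat (Suc n) * \<alpha> = \<alpha> + (\<beta> + of_nat n * \<alpha>)" "Suc n * i = i + n * i"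
    by (simp_all add: algebra_simps)
  from Suc have y: "H_bounded s ((hv_bracket x ^^ n) (H \<beta> 0)) (\<beta> + of_nat n * \<alpha>) (n * i)" ..
  show ?case
    unfolding eq funpow.simps comp_apply using H_bounded_bracket[OF x y] lookup_bracket_lead[OF s x y] Suc x \<beta>[of n]
    by (auto simp: in_keys_iff L_lead_def)
qed

text \<open>For \<alpha> \<noteq> 0 the choice \<beta> = \<alpha> works, as positive multiples of
  \<alpha> are nonzero; for \<alpha> = 0 any nonzero \<beta> does.\<close>

lemma ex_shift:
  assumes "\<alpha> \<in> \<Gamma>" "\<Gamma> \<noteq> {0}" "0 \<in> \<Gamma>"
  shows "\<exists>\<beta>\<in>\<Gamma>. \<forall>n. \<beta> + of_nat n * \<alpha> \<noteq> (0::complex)"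
proof (cases "\<alpha> = 0")
  case True
  then show ?thesis using assms by auto
next
  case False
  have "\<alpha> + of_nat n * \<alpha> = of_nat (Suc n) * \<alpha>" for n by (simp add: algebra_simps)
  then have "\<alpha> + of_nat n * \<alpha> \<noteq> 0" for n using False by (metis mult_eq_0_iff of_nat_neq_0)
  then show ?thesis using assms by blast
qed

text \<open>The iterates on a suitable \<open>H \<beta> 0\<close> keep a nonzero leading
  coefficient.\<close>

lemma not_ad_nilpotent:
  assumes "x \<in> HV \<Gamma>" "Lx \<alpha> i \<in> keys x" "\<Gamma> \<noteq> {0}" "0 \<in> \<Gamma>"
  shows "\<exists>y\<in>HV \<Gamma>. \<forall>n. (hv_bracket x ^^ n) y \<noteq> 0"
proof -
  obtain \<alpha> i where lead: "L_lead 1 x \<alpha> i" using ex_L_lead assms by blast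
  then have "\<alpha> \<in> \<Gamma>" using assms by (force simp: L_lead_def HV_eq)
  then obtain \<beta> where \<beta>: "\<beta> \<in> \<Gamma>" "\<And>n. \<beta> + of_nat n * \<alpha> \<noteq> 0" using ex_shift assms by blast
  have "(hv_bracket x ^^ n) (H \<beta> 0) \<noteq> 0" for n
    using ad_iterate_lead[OF _ lead \<beta>(2), of n] by auto
  then show ?thesis using H_in_HV[OF \<beta>(1)] by blast
qed

section \<open>Ad-locally finite elements\<close>

lemma finite_keys_fin_dim:
  assumes "hv.fin_dim_subspace W"
  shows "\<exists>E. finite E \<and> (\<forall>w\<in>W. keys w \<subseteq> E)"
proof -
  obtain B where B: "finite B" "W = hv.span B" using assms by (auto simp: hv.fin_dim_subspace_def)
  have "hv.span B \<subseteq> {w. keys w \<subseteq> (\<Union>b\<in>B. keys b)}"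
    by (rule hv.span_minimal[OF _ hv_keys_subspace]) auto
  then show ?thesis using B by (intro exI[of _ "\<Union>b\<in>B. keys b"]) auto
qed

text \<open>The leading exponents (\<beta> + n \<alpha>, n i) of the iterates are pairwise distinct
  unless \<alpha> = 0 and i = 0, so the iterates involve infinitely many basis vectors.\<close>

lemma not_ad_locally_finite:
  assumes x: "x \<in> HV \<Gamma>" and k: "Lx \<alpha>0 i0 \<in> keys x" "\<not> (\<alpha>0 = 0 \<and> i0 = 0)"
    and \<Gamma>: "\<Gamma> \<noteq> {0}" "0 \<in> \<Gamma>"
  shows "\<not> hv.ad_locally_finite (HV \<Gamma>) hv_bracket x"
proof
  assume lf: "hv.ad_locally_finite (HV \<Gamma>) hv_bracket x"
  \<comment> \<open>If the leading exponent were (0, 0) for both signs, \<open>\<alpha>0\<close>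
    would be bounded by 0 from both sides and \<open>i0\<close> would be 0.\<close>
  obtain s \<alpha> i where s: "s = 1 \<or> s = -1" and lead: "L_lead s x \<alpha> i" and nz: "\<not> (\<alpha> = 0 \<and> i = 0)"
  proof -
    obtain \<alpha> i where 1: "L_lead 1 x \<alpha> i" using ex_L_lead k by blast
    obtain \<beta> j where 2: "L_lead (-1) x \<beta> j" using ex_L_lead k by blast
    show ?thesis
    proof (cases "\<alpha> = 0 \<and> i = 0 \<and> \<beta> = 0 \<and> j = 0")
      case True
      then have "hv_key 1 \<alpha>0 i0 \<le> hv_key 1 0 0" "hv_key (-1) \<alpha>0 i0 \<le> hv_key (-1) 0 0"
        using 1 2 k by (auto simp: L_lead_def)
      then show ?thesis using k(2) by (auto simp: hv_key_def complex_eq_iff)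
    next
      case False
      then show ?thesis using that[of 1 \<alpha> i] that[of "-1" \<beta> j] 1 2 by blast
    qed
  qed
  then have "\<alpha> \<in> \<Gamma>" using x by (force simp: L_lead_def HV_eq)
  then obtain \<beta> where \<beta>: "\<beta> \<in> \<Gamma>" "\<And>n. \<beta> + of_nat n * \<alpha> \<noteq> 0" using ex_shift \<Gamma> by blast
  have "hv.fin_dim_subspace (hv.span {(hv_bracket x ^^ n) (H \<beta> 0) | n. True})"
    using lf H_in_HV[OF \<beta>(1)] by (simp add: hv.ad_locally_finite_def)
  then obtain E where E: "finite E" "\<And>w. w \<in> hv.span {(hv_bracket x ^^ n) (H \<beta> 0) | n. True} \<Longrightarrow> keys w \<subseteq> E"
    using finite_keys_fin_dim by metis
  have "Hx (\<beta> + of_nat n * \<alpha>) (n * i) \<in> E" for n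
  proof -
    have "keys ((hv_bracket x ^^ n) (H \<beta> 0)) \<subseteq> E" by (rule E(2), rule hv.span_base) auto
    then show ?thesis using ad_iterate_lead[OF s lead \<beta>(2), of n] by blast
  qed
  moreover have "inj (\<lambda>n. Hx (\<beta> + of_nat n * \<alpha>) (n * i))"
    using nz by (auto simp: inj_def)
  ultimately have "infinite E"
    by (meson finite_imageD finite_subset image_subsetI infinite_UNIV_nat)
  then show False using E by blast
qed

text \<open>Here \<open>x\<close> is a \<partial> + h with h in the span of the \<open>H\<close>
  vectors. The part a \<partial> preserves group degrees and does not raise powers of t, and h sends
  \<open>L\<close> to \<open>H\<close> and kills \<open>H\<close>, so it can act at most
  once.\<close>

lemma ad_locally_finite_of_keys:
  assumes x: "\<And>\<alpha> i. Lx \<alpha> i \<in> keys x \<Longrightarrow> \<alpha> = 0 \<and> i = 0"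
  shows "hv.ad_locally_finite V hv_bracket x"
  unfolding hv.ad_locally_finite_def
proof
  fix y :: hv
  define A where "A = hv_idx ` keys y"
  define B where "B = hv_idx ` keys x"
  define deg where "deg k = (case k of Lx \<alpha> i \<Rightarrow> i | Hx \<alpha> i \<Rightarrow> i)" for k
  \<comment> \<open>Sums serve as crude upper bounds for the powers of t, avoiding maxima of
    possibly empty sets.\<close>
  define N where "N = (\<Sum>k\<in>keys y. deg k)"
  define M where "M = (\<Sum>k\<in>keys x. deg k)"
  have N: "deg k \<le> N" if "k \<in> keys y" for k unfolding N_def using that by (intro member_le_sum) auto
  have M: "deg k \<le> M" if "k \<in> keys x" for k unfolding M_def using that by (intro member_le_sum) auto
  \<comment> \<open>The group degrees reachable by the \<open>H\<close> part: those of
    \<open>y\<close>, and those shifted once by a degree of \<open>x\<close>.\<close>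
  define C where "C = A \<union> (\<lambda>(b, a). b + a) ` (B \<times> A)"
  define K where "K = (\<lambda>(a, i). Lx a i) ` (A \<times> {..N}) \<union> (\<lambda>(a, i). Hx a i) ` (C \<times> {..M + N})"
  have K_Lx: "Lx a i \<in> K \<longleftrightarrow> a \<in> A \<and> i \<le> N" and K_Hx: "Hx a i \<in> K \<longleftrightarrow> a \<in> C \<and> i \<le> M + N" for a i
    unfolding K_def by auto
  have "finite K" by (auto simp: K_def A_def B_def C_def)
  have yK: "keys y \<subseteq> K"
  proof
    fix k assume "k \<in> keys y"
    then show "k \<in> K" using N[of k] by (cases k) (force simp: K_Lx K_Hx A_def C_def deg_def)+
  qed
  have step: "keys (hv_basis_bracket k l) \<subseteq> K" if "k \<in> keys x" "l \<in> K" for k l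
  proof (cases k)
    case (Lx \<alpha> i)
    then have "k = Lx 0 0" using x that by auto
    then show ?thesis using that
      by (cases l) (auto simp: in_keys_iff lookup_add lookup_minus L_def H_def lookup_single when_def K_Lx K_Hx
          split: if_splits)
  next
    case (Hx \<gamma> m)
    have \<gamma>: "\<gamma> \<in> B" "m \<le> M" using that(1) M[OF that(1)] Hx by (force simp: B_def deg_def)+
    show ?thesis
    proof (cases l)
      case (Lx \<alpha> i)
      then have "\<alpha> \<in> A" "i \<le> N" using that by (auto simp: K_Lx)
      then have "\<gamma> + \<alpha> \<in> C" using \<gamma> by (force simp: C_def)
      then show ?thesis using \<gamma> \<open>i \<le> N\<close> Hx Lx
        by (auto simp: in_keys_iff lookup_add lookup_minus H_def lookup_single when_def K_Hx add.commute
            split: if_splits)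
    qed (use Hx in simp)
  qed
  have "keys ((hv_bracket x ^^ n) y) \<subseteq> K" for n
  proof (induction n)
    case (Suc n)
    have "keys (hv_bracket x ((hv_bracket x ^^ n) y)) \<subseteq> K"
      using keys_hv_bracket[of x "(hv_bracket x ^^ n) y"] step Suc by blast
    then show ?case by simp
  qed (use yK in simp)
  then have "{(hv_bracket x ^^ n) y | n. True} \<subseteq> hv.span (hv_basis ` K)"
    unfolding span_hv_basis by auto
  then show "hv.fin_dim_subspace (hv.span {(hv_bracket x ^^ n) y | n. True})"
    using \<open>finite K\<close> by (intro hv.fin_dim_subspace_span[of "hv_basis ` K"]) auto
qed

lemma ad_locally_finite_iff:
  assumes "x \<in> HV \<Gamma>" "\<Gamma> \<noteq> {0}" "0 \<in> \<Gamma>"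
  shows "hv.ad_locally_finite (HV \<Gamma>) hv_bracket x \<longleftrightarrow>
    (\<forall>\<alpha> i. Lx \<alpha> i \<in> keys x \<longrightarrow> \<alpha> = 0 \<and> i = 0)"
  using not_ad_locally_finite[OF assms(1)] ad_locally_finite_of_keys assms by blast

lemma keys_hv_sum:
  assumes "finite S" "S \<subseteq> \<Gamma> \<times> UNIV"
  shows "\<forall>k\<in>keys (\<Sum>(\<alpha>, j)\<in>S. b \<alpha> j *\<^sub>h H \<alpha> j). \<exists>\<alpha> j. k = Hx \<alpha> j \<and> \<alpha> \<in> \<Gamma>"
proof -
  have "(\<Sum>(\<alpha>, j)\<in>S. b \<alpha> j *\<^sub>h H \<alpha> j) \<in> HV_H \<Gamma>"
    unfolding HV_H_def case_prod_beta
    by (intro hv.span_sum hv.span_scale hv.span_base) (use assms in force)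
  then show ?thesis by (simp add: HV_H_eq)
qed

lemma ad_locally_finite_set:
  assumes \<Gamma>: "\<Gamma> \<noteq> {0}" "0 \<in> \<Gamma>"
  shows "{x \<in> HV \<Gamma>. hv.ad_locally_finite (HV \<Gamma>) hv_bracket x}
        = {a *\<^sub>h L 0 0 + (\<Sum>(\<alpha>, j)\<in>S. b \<alpha> j *\<^sub>h H \<alpha> j) | a b S. finite S \<and> S \<subseteq> \<Gamma> \<times> UNIV}"
    (is "?l = ?r")
proof
  show "?l \<subseteq> ?r"
  proof
    fix x assume "x \<in> ?l"
    then have x: "x \<in> HV \<Gamma>" and xL: "\<And>\<alpha> i. Lx \<alpha> i \<in> keys x \<Longrightarrow> \<alpha> = 0 \<and> i = 0"
      using ad_locally_finite_iff \<Gamma> by auto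
    define S where "S = (\<lambda>k. case k of Lx \<alpha> j \<Rightarrow> (\<alpha>, j) | Hx \<alpha> j \<Rightarrow> (\<alpha>, j)) ` {k \<in> keys x. \<exists>\<alpha> j. k = Hx \<alpha> j}"
    have S_iff: "(\<alpha>, j) \<in> S \<longleftrightarrow> Hx \<alpha> j \<in> keys x" for \<alpha> j
      by (force simp: S_def split: hv_index.splits)
    have "finite S" by (simp add: S_def)
    moreover have "S \<subseteq> \<Gamma> \<times> UNIV" using x by (force simp: S_iff HV_eq)
    moreover have "x = lookup x (Lx 0 0) *\<^sub>h L 0 0 + (\<Sum>(\<alpha>, j)\<in>S. lookup x (Hx \<alpha> j) *\<^sub>h H \<alpha> j)"
      (is "x = ?y")
    proof (rule poly_mapping_eqI)
      fix k
      show "lookup x k = lookup ?y k"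
      proof (cases k)
        case (Lx \<alpha> i)
        have "lookup x (Lx \<alpha> i) = 0" if "\<not> (\<alpha> = 0 \<and> i = 0)"
          using xL that by (auto simp: in_keys_iff)
        then show ?thesis unfolding Lx
          by (auto simp: lookup_add lookup_sum case_prod_beta L_def H_def lookup_single when_def)
      next
        case (Hx \<beta> m)
        have "lookup ?y k = (\<Sum>p\<in>S. if p = (\<beta>, m) then lookup x (Hx \<beta> m) else 0)"
          unfolding Hx lookup_add lookup_sum
          by (simp add: L_def H_def lookup_single when_def case_prod_beta)
            (intro sum.cong, auto)
        also have "\<dots> = lookup x k"
          using \<open>finite S\<close> by (auto simp: sum.delta' sum.delta Hx S_iff in_keys_iff)
        finally show ?thesis by simp
      qed
    qed
    ultimately show "x \<in> ?r"
      by (intro CollectI exI[of _ "lookup x (Lx 0 0)"] exI[of _ "\<lambda>\<alpha> j. lookup x (Hx \<alpha> j)"] exI[of _ S] conjI)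
  qed
  show "?r \<subseteq> ?l"
  proof
    fix x assume "x \<in> ?r"
    then obtain a b S where x: "x = a *\<^sub>h L 0 0 + (\<Sum>(\<alpha>, j)\<in>S. b \<alpha> j *\<^sub>h H \<alpha> j)"
      and S: "finite S" "S \<subseteq> \<Gamma> \<times> UNIV" by blast
    have keys: "keys x \<subseteq> {Lx 0 0} \<union> {Hx \<alpha> j | \<alpha> j. \<alpha> \<in> \<Gamma>}"
    proof -
      have "keys x \<subseteq> keys (a *\<^sub>h L 0 0) \<union> keys (\<Sum>(\<alpha>, j)\<in>S. b \<alpha> j *\<^sub>h H \<alpha> j)"
        unfolding x by (rule Poly_Mapping.keys_add)
      then show ?thesis using keys_hv_sum[OF S, of b] keys_scale_subset[of a "L 0 0"] by fastforce
    qed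
    then have "x \<in> HV \<Gamma>" using \<Gamma> by (fastforce simp: HV_eq)
    moreover from keys have "\<And>\<alpha> i. Lx \<alpha> i \<in> keys x \<Longrightarrow> \<alpha> = 0 \<and> i = 0" by auto
    ultimately show "x \<in> ?l" using ad_locally_finite_of_keys by blast
  qed
qed

subsection \<open>Ideals\<close>

text \<open>Common setting for the \<open>H\<close> vectors and the pure \<open>L\<close> vectors of
  an ideal: on either family \<open>L 0 0\<close> acts by the same formula.\<close>

locale L00_stable =
  fixes J :: "hv set" and c :: "complex \<Rightarrow> nat \<Rightarrow> hv_index"
  assumes c: "c = Lx \<or> c = Hx"
    and sub: "hv.subspace J"
    and stable: "y \<in> J \<Longrightarrow> hv_bracket (L 0 0) y \<in> J"
    and only: "y \<in> J \<Longrightarrow> k \<in> keys y \<Longrightarrow> \<exists>\<beta> j. k = c \<beta> j"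
begin

text \<open>The operator \<partial> - \<gamma>: on the part of degree \<gamma> it is differentiation
  in t, hence locally nilpotent, and on the other degrees it is injective.\<close>

definition shift :: "complex \<Rightarrow> hv \<Rightarrow> hv" where
  "shift \<gamma> y = hv_bracket (L 0 0) y - \<gamma> *\<^sub>h y"

lemma shift_in: "y \<in> J \<Longrightarrow> shift \<gamma> y \<in> J"
  unfolding shift_def by (intro hv.subspace_diff[OF sub] hv.subspace_scale[OF sub] stable)

lemma lookup_shift:
  "lookup (shift \<gamma> y) (c \<beta> j) = (\<beta> - \<gamma>) * lookup y (c \<beta> j) + of_nat (Suc j) * lookup y (c \<beta> (Suc j))"
  by (simp add: shift_def lookup_minus lookup_bracket_L00[OF c] algebra_simps)

lemma c_inject [simp]: "c \<alpha> i = c \<beta> j \<longleftrightarrow> \<alpha> = \<beta> \<and> i = j"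
  using c by auto

lemma idx_c [simp]: "hv_idx (c \<alpha> i) = \<alpha>"
  using c by auto

lemma ex_top:
  assumes "lookup y (c \<alpha> j) \<noteq> 0"
  shows "\<exists>d\<ge>j. lookup y (c \<alpha> d) \<noteq> 0 \<and> (\<forall>j>d. lookup y (c \<alpha> j) = 0)"
proof -
  let ?A = "{j. lookup y (c \<alpha> j) \<noteq> 0}"
  have "(c \<alpha>) -` keys y = ?A" by (auto simp: in_keys_iff)
  moreover have "finite ((c \<alpha>) -` keys y)" by (intro finite_vimageI) (auto simp: inj_def)
  ultimately have fin: "finite ?A" by simp
  have "Max ?A \<in> ?A" by (rule Max_in[OF fin]) (use assms in blast)
  moreover have "j \<le> Max ?A" by (rule Max_ge[OF fin]) (use assms in blast)
  moreover have "lookup y (c \<alpha> i) = 0" if "i > Max ?A" for i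
    using Max_ge[OF fin, of i] that by auto
  ultimately show ?thesis by blast
qed

text \<open>Iterating \<open>shift \<gamma>\<close> exhausts the degree \<gamma> part, losing one
  power of t each time. The top coefficient in degree \<alpha> is only multiplied by \<alpha> -
  \<gamma>, and no new degrees arise, so different \<gamma> can be treated in turn.\<close>

lemma kill_index:
  assumes "y \<in> J" "\<exists>j. lookup y (c \<alpha> j) \<noteq> 0" "\<gamma> \<noteq> \<alpha>"
  shows "\<exists>y'\<in>J. (\<exists>j. lookup y' (c \<alpha> j) \<noteq> 0) \<and> (\<forall>j. lookup y' (c \<gamma> j) = 0) \<and>
    (\<forall>\<beta>. (\<forall>j. lookup y (c \<beta> j) = 0) \<longrightarrow> (\<forall>j. lookup y' (c \<beta> j) = 0))"
proof -
  have *: "\<exists>y'\<in>J. (\<exists>j. lookup y' (c \<alpha> j) \<noteq> 0) \<and> (\<forall>j. lookup y' (c \<gamma> j) = 0) \<and>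
    (\<forall>\<beta>. (\<forall>j. lookup y (c \<beta> j) = 0) \<longrightarrow> (\<forall>j. lookup y' (c \<beta> j) = 0))"
    if "y \<in> J" "\<exists>j. lookup y (c \<alpha> j) \<noteq> 0" "\<forall>j\<ge>N. lookup y (c \<gamma> j) = 0" for N y
    using that
  proof (induction N arbitrary: y)
    case 0
    then show ?case by auto
  next
    case (Suc N)
    obtain d where d: "lookup y (c \<alpha> d) \<noteq> 0" "\<forall>j>d. lookup y (c \<alpha> j) = 0"
      using Suc.prems ex_top by blast
    have "lookup (shift \<gamma> y) (c \<alpha> d) \<noteq> 0"
      using d assms(3) by (simp add: lookup_shift)
    moreover have "\<forall>j\<ge>N. lookup (shift \<gamma> y) (c \<gamma> j) = 0"
      using Suc.prems by (simp add: lookup_shift)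
    ultimately obtain y' where y': "y' \<in> J" "\<exists>j. lookup y' (c \<alpha> j) \<noteq> 0" "\<forall>j. lookup y' (c \<gamma> j) = 0"
      "\<forall>\<beta>. (\<forall>j. lookup (shift \<gamma> y) (c \<beta> j) = 0) \<longrightarrow> (\<forall>j. lookup y' (c \<beta> j) = 0)"
      using Suc.IH[OF shift_in[OF Suc.prems(1), of \<gamma>]] by blast
    moreover have "(\<forall>j. lookup (shift \<gamma> y) (c \<beta> j) = 0)" if "\<forall>j. lookup y (c \<beta> j) = 0" for \<beta>
      using that by (simp add: lookup_shift)
    ultimately show ?case by blast
  qed
  have "\<exists>N. \<forall>j\<ge>N. lookup y (c \<gamma> j) = 0"
  proof (cases "\<exists>j. lookup y (c \<gamma> j) \<noteq> 0")
    case True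
    then obtain d where "\<forall>j>d. lookup y (c \<gamma> j) = 0" using ex_top by blast
    then show ?thesis by (intro exI[of _ "Suc d"]) auto
  qed auto
  then show ?thesis using * assms by blast
qed

lemma isolate_index:
  assumes "y \<in> J" "lookup y (c \<alpha> j) \<noteq> 0"
  shows "\<exists>y'\<in>J. (\<exists>j. lookup y' (c \<alpha> j) \<noteq> 0) \<and> (\<forall>\<beta> j. \<beta> \<noteq> \<alpha> \<longrightarrow> lookup y' (c \<beta> j) = 0)"
proof -
  have "\<exists>y'\<in>J. (\<exists>j. lookup y' (c \<alpha> j) \<noteq> 0) \<and> (\<forall>\<beta> j. \<beta> \<noteq> \<alpha> \<longrightarrow> lookup y' (c \<beta> j) = 0)"
    if "finite F" "y \<in> J" "\<exists>j. lookup y (c \<alpha> j) \<noteq> 0" "\<alpha> \<notin> F"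
      "\<forall>\<beta> j. \<beta> \<notin> insert \<alpha> F \<longrightarrow> lookup y (c \<beta> j) = 0" for F y
    using that
  proof (induction F arbitrary: y rule: finite_induct)
    case empty
    then show ?case by auto
  next
    case (insert \<gamma> F)
    obtain y' where y': "y' \<in> J" "\<exists>j. lookup y' (c \<alpha> j) \<noteq> 0" "\<forall>j. lookup y' (c \<gamma> j) = 0"
      "\<forall>\<beta>. (\<forall>j. lookup y (c \<beta> j) = 0) \<longrightarrow> (\<forall>j. lookup y' (c \<beta> j) = 0)"
      using kill_index[OF insert.prems(1,2), of \<gamma>] insert.prems by auto
    have "\<forall>\<beta> j. \<beta> \<notin> insert \<alpha> F \<longrightarrow> lookup y' (c \<beta> j) = 0"
    proof (intro allI impI)
      fix \<beta> j assume "\<beta> \<notin> insert \<alpha> F"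
      then show "lookup y' (c \<beta> j) = 0"
        using y'(3,4) insert.prems(4) by (cases "\<beta> = \<gamma>") auto
    qed
    then show ?case using insert.IH[OF y'(1,2)] insert.prems(3) by blast
  qed
  from this[of "hv_idx ` keys y - {\<alpha>}" y] assms show ?thesis
    by (force simp: in_keys_iff image_iff)
qed

text \<open>With a single degree \<alpha> present, \<open>shift \<alpha>\<close> is d/dt: it lowers
  the power of t by exactly one and multiplies the leading coefficient by a positive integer. It is
  stopped at \<open>m\<close>.\<close>

lemma lower_degree:
  assumes "y \<in> J" "\<forall>\<beta> j. \<beta> \<noteq> \<alpha> \<longrightarrow> lookup y (c \<beta> j) = 0" "lookup y (c \<alpha> j) \<noteq> 0" "m \<le> j"
  shows "\<exists>a. a \<noteq> 0 \<and> (\<exists>y'\<in>J. lookup y' (c \<alpha> m) = a \<and> (\<forall>i>m. lookup y' (c \<alpha> i) = 0) \<and>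
    (\<forall>\<beta> j. \<beta> \<noteq> \<alpha> \<longrightarrow> lookup y' (c \<beta> j) = 0))"
proof -
  have *: ?thesis
    if "y \<in> J" "\<forall>\<beta> j. \<beta> \<noteq> \<alpha> \<longrightarrow> lookup y (c \<beta> j) = 0" "lookup y (c \<alpha> d) \<noteq> 0" "\<forall>i>d. lookup y (c \<alpha> i) = 0"
      "m \<le> d" for y d
    using that
  proof (induction d arbitrary: y)
    case 0
    then show ?case by auto
  next
    case (Suc d)
    show ?case
    proof (cases "m = Suc d")
      case True
      then show ?thesis using Suc.prems by auto
    next
      case False
      show ?thesis
      proof (rule Suc.IH[of "shift \<alpha> y"])
        show "shift \<alpha> y \<in> J" using Suc.prems by (intro shift_in)
        show "\<forall>\<beta> j. \<beta> \<noteq> \<alpha> \<longrightarrow> lookup (shift \<alpha> y) (c \<beta> j) = 0"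
          using Suc.prems by (simp add: lookup_shift)
        show "lookup (shift \<alpha> y) (c \<alpha> d) \<noteq> 0"
          using Suc.prems by (simp add: lookup_shift del: of_nat_Suc)
        show "\<forall>i>d. lookup (shift \<alpha> y) (c \<alpha> i) = 0"
          using Suc.prems by (simp add: lookup_shift)
        show "m \<le> d" using False Suc.prems by simp
      qed
    qed
  qed
  obtain d where "d \<ge> j" "lookup y (c \<alpha> d) \<noteq> 0" "\<forall>i>d. lookup y (c \<alpha> i) = 0"
    using ex_top assms by blast
  then show ?thesis using *[of y d] assms by auto
qed

text \<open>Isolate the degree \<alpha> and differentiate in t down to a constant: what remains is
  an eigenvector of \<partial>.\<close>

lemma basis_in:
  assumes "y \<in> J" "lookup y (c \<alpha> j) \<noteq> 0"
  shows "hv_basis (c \<alpha> 0) \<in> J"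
proof -
  obtain y' j' where "y' \<in> J" "lookup y' (c \<alpha> j') \<noteq> 0" "\<forall>\<beta> j. \<beta> \<noteq> \<alpha> \<longrightarrow> lookup y' (c \<beta> j) = 0"
    using isolate_index[OF assms] by blast
  then obtain a z where a: "a \<noteq> 0" and z: "z \<in> J" "lookup z (c \<alpha> 0) = a" "\<forall>i>0. lookup z (c \<alpha> i) = 0"
    "\<forall>\<beta> j. \<beta> \<noteq> \<alpha> \<longrightarrow> lookup z (c \<beta> j) = 0"
    using lower_degree[of y' \<alpha> j' 0] by blast
  have "hv_basis (c \<alpha> 0) = (1 / a) *\<^sub>h z"
  proof (rule poly_mapping_eqI)
    fix k
    show "lookup (hv_basis (c \<alpha> 0)) k = lookup ((1 / a) *\<^sub>h z) k"
    proof (cases "k \<in> keys z")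
      case True
      then obtain \<beta> i where k: "k = c \<beta> i" using only z(1) by blast
      then have "\<beta> = \<alpha>" using True z(4) by (auto simp: in_keys_iff)
      moreover from this have "i = 0" using True z(3) k by (cases i) (auto simp: in_keys_iff)
      ultimately have "\<beta> = \<alpha>" "i = 0" .
      then show ?thesis using k z(2) a by simp
    next
      case False
      then have "k \<noteq> c \<alpha> 0" using z(2) a by (auto simp: in_keys_iff)
      then show ?thesis using False by (auto simp: lookup_single when_def in_keys_iff)
    qed
  qed
  then show ?thesis using z(1) hv.subspace_scale[OF sub] by simp
qed

end

lemma HV_H_lie_ideal:
  assumes "\<And>a b. a \<in> \<Gamma> \<Longrightarrow> b \<in> \<Gamma> \<Longrightarrow> a + b \<in> \<Gamma>"
  shows "hv.lie_ideal (HV \<Gamma>) hv_bracket (HV_H \<Gamma>)"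
  unfolding hv.lie_ideal_def
proof (intro conjI ballI)
  show "hv.subspace (HV_H \<Gamma>)" by (simp add: HV_H_def)
  show "HV_H \<Gamma> \<subseteq> HV \<Gamma>" by (rule HV_H_subset)
next
  fix x y assume x: "x \<in> HV \<Gamma>" and y: "y \<in> HV_H \<Gamma>"
  have 1: "hv_bracket x y \<in> HV \<Gamma>"
    using hv_bracket_closed[OF assms x] HV_H_subset y by blast
  have "\<exists>\<alpha> i. k = Hx \<alpha> i" if k: "k \<in> keys (hv_bracket x y)" for k
  proof -
    obtain a b where ab: "a \<in> keys x" "b \<in> keys y" "k \<in> keys (hv_basis_bracket a b)"
      using k keys_hv_bracket[of x y] by blast
    then obtain \<beta> j where b: "b = Hx \<beta> j" using y by (auto simp: HV_H_eq)
    show ?thesis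
    proof (cases a)
      case (Lx \<alpha> i)
      then show ?thesis using ab(3) keys_LH_bracket[of \<alpha> i \<beta> j] b by (auto split: if_splits)
    qed (use ab(3) b in simp)
  qed
  then show "hv_bracket x y \<in> HV_H \<Gamma>"
    using 1 by (force simp: HV_eq HV_H_eq)
qed

text \<open>\<open>H 0 0\<close> is the constant 1, annihilated by every derivation f \<partial>,
  and is therefore central.\<close>

lemma hv_bracket_H00:
  assumes "keys y \<subseteq> {Hx 0 0}"
  shows "hv_bracket x y = 0"
proof -
  have "hv_basis_bracket k (Hx 0 0) = 0" for k by (cases k) auto
  then have "keys (hv_bracket x y) \<subseteq> {}"
    using keys_hv_bracket[of x y] assms by fastforce
  then show ?thesis by simp
qed

lemma span_H00_lie_ideal:
  assumes "0 \<in> \<Gamma>"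
  shows "hv.lie_ideal (HV \<Gamma>) hv_bracket (hv.span {H 0 0})"
  unfolding hv.lie_ideal_def span_singleton_H
  using assms hv_keys_subspace[of "{Hx 0 0}"] hv_bracket_H00 by (auto simp: HV_eq)

section \<open>Classification of the ideals\<close>

locale hv_group =
  fixes \<Gamma> :: "complex set"
  assumes zero: "0 \<in> \<Gamma>"
    and add: "\<And>a b. a \<in> \<Gamma> \<Longrightarrow> b \<in> \<Gamma> \<Longrightarrow> a + b \<in> \<Gamma>"
    and neg: "\<And>a. a \<in> \<Gamma> \<Longrightarrow> - a \<in> \<Gamma>"
    and nontriv: "\<Gamma> \<noteq> {0}"
begin

lemma diff: "a \<in> \<Gamma> \<Longrightarrow> b \<in> \<Gamma> \<Longrightarrow> a - b \<in> \<Gamma>"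
  using add[of a "-b"] neg by simp

text \<open>If \<open>y\<close> involves a degree \<alpha> \<noteq> 0, then
  \<open>H \<alpha> 0\<close> is in \<open>I\<close>, and bracketing
  \<open>L (\<beta> - \<alpha>) i\<close> with it gives \<alpha> times \<open>H \<beta> i\<close>.
  Otherwise \<open>y\<close> is a nonconstant polynomial in t, and a multiple of t plus a constant
  takes the place of \<open>H \<alpha> 0\<close>.\<close>

lemma HV_H_subset_ideal:
  assumes I: "hv.lie_ideal (HV \<Gamma>) hv_bracket I" and y: "y \<in> I" "y \<in> HV_H \<Gamma>" "y \<notin> hv.span {H 0 0}"
  shows "HV_H \<Gamma> \<subseteq> I"
proof -
  have Isub: "hv.subspace I" and I_br: "\<And>x y. x \<in> HV \<Gamma> \<Longrightarrow> y \<in> I \<Longrightarrow> hv_bracket x y \<in> I"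
    using I by (auto simp: hv.lie_ideal_def)
  have scaled: "z \<in> I" if "a *\<^sub>h z \<in> I" "a \<noteq> 0" for a z
    using hv.subspace_scale[OF Isub that(1), of "1 / a"] that(2) by simp
  interpret J: L00_stable "I \<inter> HV_H \<Gamma>" Hx
  proof
    show "hv.subspace (I \<inter> HV_H \<Gamma>)"
      using Isub by (intro hv.subspace_inter) (auto simp: HV_H_def)
  next
    fix y assume "y \<in> I \<inter> HV_H \<Gamma>"
    then show "hv_bracket (L 0 0) y \<in> I \<inter> HV_H \<Gamma>"
      using I_br HV_H_lie_ideal[OF add] L_in_HV[OF zero] by (auto simp: hv.lie_ideal_def)
  qed (auto simp: HV_H_eq)
  have "H \<beta> i \<in> I" if \<beta>: "\<beta> \<in> \<Gamma>" for \<beta> i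
  proof (cases "\<exists>\<alpha> j. \<alpha> \<noteq> 0 \<and> Hx \<alpha> j \<in> keys y")
    case True
    then obtain \<alpha> j where \<alpha>: "\<alpha> \<noteq> 0" "Hx \<alpha> j \<in> keys y" by auto
    then have "\<alpha> \<in> \<Gamma>" using y(2) by (force simp: HV_H_eq)
    have "H \<alpha> 0 \<in> I" using J.basis_in[of y \<alpha> j] y \<alpha> by (auto simp: H_def in_keys_iff)
    then have "hv_bracket (L (\<beta> - \<alpha>) i) (H \<alpha> 0) \<in> I"
      using \<beta> \<open>\<alpha> \<in> \<Gamma>\<close> by (intro I_br L_in_HV diff)
    then show ?thesis using scaled \<alpha> by (simp add: hv_bracket_basis_simps)
  next
    case False
    obtain k where k: "k \<in> keys y" "k \<noteq> Hx 0 0" using y(3) by (auto simp: span_singleton_H)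
    obtain \<alpha> j where "k = Hx \<alpha> j" using y(2) k(1) unfolding HV_H_eq by blast
    moreover from this have "\<alpha> = 0" using False k by blast
    ultimately have j: "Hx 0 j \<in> keys y" "j \<noteq> 0" using k by auto
    have "\<forall>\<beta> j. \<beta> \<noteq> 0 \<longrightarrow> lookup y (Hx \<beta> j) = 0"
      using False by (auto simp: in_keys_iff)
    moreover have "lookup y (Hx 0 j) \<noteq> 0" "1 \<le> j" using j by (auto simp: in_keys_iff)
    \<comment> \<open>Stopping at power 1 rather than 0 matters: the constants are central and
      generate nothing more.\<close>
    ultimately obtain a z where a: "a \<noteq> 0" and z: "z \<in> I \<inter> HV_H \<Gamma>" "lookup z (Hx 0 1) = a"
      "\<forall>i>1. lookup z (Hx 0 i) = 0" "\<forall>\<beta> j. \<beta> \<noteq> 0 \<longrightarrow> lookup z (Hx \<beta> j) = 0"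
      using J.lower_degree[of y 0 j 1] y by blast
    \<comment> \<open>Up to a central constant, \<open>z\<close> is a times t, and the bracket of
      \<open>L \<beta> i\<close> with t is \<open>H \<beta> i\<close>.\<close>
    have "keys (z - a *\<^sub>h H 0 1) \<subseteq> {Hx 0 0}"
    proof
      fix k assume k: "k \<in> keys (z - a *\<^sub>h H 0 1)"
      show "k \<in> {Hx 0 0}"
      proof (cases k)
        case (Lx \<alpha> i)
        then have "lookup z k = 0" using z(1) by (auto simp: HV_H_eq in_keys_iff)
        then show ?thesis using k Lx by (simp add: in_keys_iff lookup_minus H_def lookup_single)
      next
        case (Hx \<alpha> i)
        then show ?thesis using k z(2-4)
          by (cases "\<alpha> = 0"; cases "i > 1"; cases "i = 1")
            (auto simp: in_keys_iff lookup_minus H_def lookup_single when_def)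
      qed
    qed
    then have "hv_bracket (L \<beta> i) (z - a *\<^sub>h H 0 1) = 0" by (rule hv_bracket_H00)
    then have "hv_bracket (L \<beta> i) z = a *\<^sub>h H \<beta> i"
      by (simp add: hv_bracket_diff_right hv_bracket_scale_right hv_bracket_basis_simps)
    moreover have "hv_bracket (L \<beta> i) z \<in> I" using z(1) \<beta> by (intro I_br L_in_HV) auto
    ultimately show ?thesis using scaled a by simp
  qed
  then show ?thesis
    unfolding HV_H_def by (intro hv.span_minimal[OF _ Isub]) auto
qed

text \<open>The bracket of \<open>L (\<gamma> - \<alpha>) j\<close> with \<open>L \<alpha> 0\<close>
  is \<open>L \<gamma> j\<close> with coefficient 2\<alpha> - \<gamma>, minus j times
  \<open>L \<gamma> (j - 1)\<close>. This triangular relation is solved by induction on j.\<close>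

lemma L_in_ideal:
  assumes I: "hv.lie_ideal (HV \<Gamma>) hv_bracket I" and \<alpha>: "\<alpha> \<in> \<Gamma>" "L \<alpha> 0 \<in> I"
    and \<gamma>: "\<gamma> \<in> \<Gamma>" "\<gamma> \<noteq> 2 * \<alpha>"
  shows "L \<gamma> j \<in> I"
proof -
  have Isub: "hv.subspace I" and I_br: "\<And>x y. x \<in> HV \<Gamma> \<Longrightarrow> y \<in> I \<Longrightarrow> hv_bracket x y \<in> I"
    using I by (auto simp: hv.lie_ideal_def)
  have br: "hv_bracket (L (\<gamma> - \<alpha>) j) (L \<alpha> 0) \<in> I" for j
    using \<alpha> \<gamma> by (intro I_br L_in_HV diff)
  have eq: "hv_bracket (L (\<gamma> - \<alpha>) j) (L \<alpha> 0) = (2 * \<alpha> - \<gamma>) *\<^sub>h L \<gamma> j - of_nat j *\<^sub>h L \<gamma> (j - 1)" for j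
    by (simp add: hv_bracket_basis_simps algebra_simps)
  have scaled: "z \<in> I" if "a *\<^sub>h z \<in> I" "a \<noteq> 0" for a z
    using hv.subspace_scale[OF Isub that(1), of "1 / a"] that(2) by simp
  show ?thesis
  proof (induction j)
    case 0
    show ?case using br[of 0] eq[of 0] scaled \<gamma> by simp
  next
    case (Suc j)
    have "(2 * \<alpha> - \<gamma>) *\<^sub>h L \<gamma> (Suc j) =
      hv_bracket (L (\<gamma> - \<alpha>) (Suc j)) (L \<alpha> 0) + of_nat (Suc j) *\<^sub>h L \<gamma> j"
      by (simp add: eq)
    also have "\<dots> \<in> I" using br Suc by (intro hv.subspace_add[OF Isub] hv.subspace_scale[OF Isub])
    finally show ?case using scaled \<gamma> by simp
  qed
qed

text \<open>Bracketing \<open>x\<close> with a suitable \<open>H \<beta> 0\<close> gives a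
  noncentral element of \<open>HV_H\<close>, so \<open>HV_H\<close> is in \<open>I\<close>. Removing
  the \<open>H\<close> part of \<open>x\<close> then leaves a nonzero pure \<open>L\<close> element,
  from which \<open>L \<alpha> 0\<close> and finally all basis vectors are obtained.\<close>

lemma ideal_eq_HV:
  assumes I: "hv.lie_ideal (HV \<Gamma>) hv_bracket I" and x: "x \<in> I" "x \<notin> HV_H \<Gamma>"
  shows "I = HV \<Gamma>"
proof -
  have Isub: "hv.subspace I" and I_br: "\<And>x y. x \<in> HV \<Gamma> \<Longrightarrow> y \<in> I \<Longrightarrow> hv_bracket x y \<in> I"
    and IV: "I \<subseteq> HV \<Gamma>"
    using I by (auto simp: hv.lie_ideal_def)
  have xV: "x \<in> HV \<Gamma>" using x IV by auto
  obtain \<alpha>0 i0 where "Lx \<alpha>0 i0 \<in> keys x"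
  proof -
    obtain k where "k \<in> keys x" "\<nexists>\<alpha> i. k = Hx \<alpha> i \<and> \<alpha> \<in> \<Gamma>" using x by (auto simp: HV_H_eq)
    then show ?thesis using that xV by (cases k) (force simp: HV_eq)+
  qed
  then obtain \<alpha> i where lead: "L_lead 1 x \<alpha> i" using ex_L_lead by blast
  then have \<alpha>: "\<alpha> \<in> \<Gamma>" "lookup x (Lx \<alpha> i) \<noteq> 0" using xV by (force simp: L_lead_def HV_eq in_keys_iff)+
  obtain \<beta> where \<beta>: "\<beta> \<in> \<Gamma>" "\<And>n. \<beta> + of_nat n * \<alpha> \<noteq> 0" using ex_shift[OF \<alpha>(1) nontriv zero] by blast
  have "hv_bracket (H \<beta> 0) x \<in> I" using x \<beta> by (intro I_br H_in_HV)
  then have in_I: "hv_bracket x (H \<beta> 0) \<in> I"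
    using hv.subspace_neg[OF Isub] by (metis hv_bracket_swap)
  have "H \<beta> 0 \<in> HV_H \<Gamma>" using \<beta> by (auto simp: HV_H_eq)
  then have in_H: "hv_bracket x (H \<beta> 0) \<in> HV_H \<Gamma>"
    using HV_H_lie_ideal[OF add] xV by (auto simp: hv.lie_ideal_def)
  \<comment> \<open>The first iterate has its leading term in a nonzero degree, hence lies outside
    the span of \<open>H 0 0\<close>.\<close>
  have "Hx (\<beta> + \<alpha>) i \<in> keys (hv_bracket x (H \<beta> 0))" "\<beta> + \<alpha> \<noteq> 0"
    using ad_iterate_lead[OF _ lead \<beta>(2), of 1] \<beta>(2)[of 1] by auto
  then have "hv_bracket x (H \<beta> 0) \<notin> hv.span {H 0 0}" by (auto simp: span_singleton_H)
  then have HI: "HV_H \<Gamma> \<subseteq> I" using HV_H_subset_ideal[OF I in_I in_H] by blast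
  interpret J: L00_stable "I \<inter> {y. keys y \<subseteq> {k. \<exists>\<alpha> i. k = Lx \<alpha> i}}" Lx
  proof
    show "hv.subspace (I \<inter> {y. keys y \<subseteq> {k. \<exists>\<alpha> i. k = Lx \<alpha> i}})"
      by (intro hv.subspace_inter Isub hv_keys_subspace)
  next
    fix y assume y: "y \<in> I \<inter> {y. keys y \<subseteq> {k. \<exists>\<alpha> i. k = Lx \<alpha> i}}"
    have "\<exists>\<alpha> i. k = Lx \<alpha> i" if k: "k \<in> keys (hv_bracket (L 0 0) y)" for k
    proof (cases k)
      case (Hx \<beta> j)
      have "lookup y (Hx \<beta> j) = 0" "lookup y (Hx \<beta> (Suc j)) = 0"
        using y by (auto simp: in_keys_iff subset_iff)
      then show ?thesis using k Hx by (simp add: in_keys_iff lookup_bracket_L00)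
    qed auto
    then show "hv_bracket (L 0 0) y \<in> I \<inter> {y. keys y \<subseteq> {k. \<exists>\<alpha> i. k = Lx \<alpha> i}}"
      using I_br[OF L_in_HV[OF zero]] y by auto
  qed auto
  define z where "z = (\<Sum>k\<in>keys x \<inter> {k. \<exists>\<alpha> i. k = Hx \<alpha> i}. lookup x k *\<^sub>h hv_basis k)"
  have "z \<in> HV_H \<Gamma>"
    unfolding z_def HV_H_def
  proof (intro hv.span_sum hv.span_scale hv.span_base)
    fix k assume "k \<in> keys x \<inter> {k. \<exists>\<alpha> i. k = Hx \<alpha> i}"
    then show "hv_basis k \<in> {H \<alpha> i |\<alpha> i. \<alpha> \<in> \<Gamma>}" using xV by (force simp: HV_eq H_def)
  qed
  have lookup_z: "lookup z k = (if \<exists>\<alpha> i. k = Hx \<alpha> i then lookup x k else 0)" for k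
    unfolding z_def
    by (auto simp: lookup_sum lookup_single when_def in_keys_iff if_distrib[of "(*) _"] cong: if_cong)
  have "x - z \<in> I" using x HI \<open>z \<in> HV_H \<Gamma>\<close> by (intro hv.subspace_diff[OF Isub]) auto
  moreover have "keys (x - z) \<subseteq> {k. \<exists>\<alpha> i. k = Lx \<alpha> i}"
  proof
    fix k assume "k \<in> keys (x - z)"
    then show "k \<in> {k. \<exists>\<alpha> i. k = Lx \<alpha> i}"
      by (cases k) (auto simp: in_keys_iff lookup_minus lookup_z)
  qed
  moreover have "lookup (x - z) (Lx \<alpha> i) \<noteq> 0" using \<alpha> by (simp add: lookup_minus lookup_z)
  ultimately have "L \<alpha> 0 \<in> I" using J.basis_in[of "x - z" \<alpha> i] by (auto simp: L_def)
  \<comment> \<open>A second starting point for the value 2\<alpha> missed by \<alpha>: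
    \<open>\<delta> \<noteq> 2 * \<alpha>\<close> puts \<open>L \<delta> 0\<close> in
    \<open>I\<close>, and \<open>\<delta> \<noteq> \<alpha>\<close> makes the value missed by
    \<delta> a different one.\<close>
  obtain \<delta> where \<delta>: "\<delta> \<in> \<Gamma>" "\<delta> \<noteq> 2 * \<alpha>" "\<delta> \<noteq> \<alpha>"
  proof (cases "\<alpha> = 0")
    case True
    then show ?thesis using that nontriv zero by auto
  next
    case False
    then show ?thesis using that[of 0] zero by auto
  qed
  then have "L \<delta> 0 \<in> I" using L_in_ideal[OF I \<alpha>(1) \<open>L \<alpha> 0 \<in> I\<close>] by blast
  have "L \<gamma> j \<in> I" if "\<gamma> \<in> \<Gamma>" for \<gamma> j
    using L_in_ideal[OF I \<alpha>(1) \<open>L \<alpha> 0 \<in> I\<close> that] L_in_ideal[OF I \<delta>(1) \<open>L \<delta> 0 \<in> I\<close> that] \<delta>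
    by (cases "\<gamma> = 2 * \<alpha>") auto
  moreover have "H \<gamma> j \<in> I" if "\<gamma> \<in> \<Gamma>" for \<gamma> j
    using that HI by (auto simp: HV_H_eq)
  ultimately have "HV \<Gamma> \<subseteq> I"
    unfolding HV_def by (intro hv.span_minimal[OF _ Isub]) auto
  then show ?thesis using IV by auto
qed

lemma ideal_cases:
  assumes I: "hv.lie_ideal (HV \<Gamma>) hv_bracket I"
  shows "I = {0} \<or> I = hv.span {H 0 0} \<or> I = HV_H \<Gamma> \<or> I = HV \<Gamma>"
proof (cases "I \<subseteq> HV_H \<Gamma>")
  case True
  have Isub: "hv.subspace I" using I by (auto simp: hv.lie_ideal_def)
  show ?thesis
  proof (cases "I \<subseteq> hv.span {H 0 0}")
    case sub: True
    show ?thesis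
    proof (cases "I = {0}")
      case False
      then obtain y where y: "y \<in> I" "y \<noteq> 0" using hv.subspace_0[OF Isub] by auto
      then have "y \<in> hv.span {H 0 0}" using sub by auto
      then obtain a where a: "y = a *\<^sub>h H 0 0" by (auto simp: hv.span_singleton)
      then have "a \<noteq> 0" using y by auto
      then have "H 0 0 = (1 / a) *\<^sub>h y" by (simp add: a)
      then have "H 0 0 \<in> I" using y hv.subspace_scale[OF Isub] by simp
      then show ?thesis using sub hv.span_minimal[OF _ Isub, of "{H 0 0}"] by auto
    qed simp
  next
    case False
    then obtain y where "y \<in> I" "y \<notin> hv.span {H 0 0}" by auto
    then show ?thesis using HV_H_subset_ideal[OF I] True by blast
  qed
next
  case False
  then show ?thesis using ideal_eq_HV[OF I] by blast
qed

lemma distinct_ideals: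
  "hv.span {H 0 0} \<noteq> {0}" "HV_H \<Gamma> \<noteq> {0}" "HV_H \<Gamma> \<noteq> HV \<Gamma>" "hv.span {H 0 0} \<noteq> HV \<Gamma>"
  "hv.span {H 0 0} \<noteq> HV_H \<Gamma>" "{0} \<noteq> HV \<Gamma>"
proof -
  have 1: "H 0 0 \<in> hv.span {H 0 0}" "H 0 1 \<notin> hv.span {H 0 0}" "H 0 1 \<in> HV_H \<Gamma>"
    "L 0 0 \<in> HV \<Gamma>" "L 0 0 \<notin> HV_H \<Gamma>" "H 0 1 \<in> HV \<Gamma>"
    using zero by (auto simp: span_singleton_H HV_H_eq HV_eq)
  show "hv.span {H 0 0} \<noteq> {0}" "HV_H \<Gamma> \<noteq> {0}" "HV_H \<Gamma> \<noteq> HV \<Gamma>" "hv.span {H 0 0} \<noteq> HV \<Gamma>"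
    "hv.span {H 0 0} \<noteq> HV_H \<Gamma>" "{0} \<noteq> HV \<Gamma>"
    using 1 H_ne_0 L_ne_0 by blast+
qed

lemma proper_ideals:
  "{I. hv.lie_ideal (HV \<Gamma>) hv_bracket I \<and> I \<noteq> {0} \<and> I \<noteq> HV \<Gamma>} = {hv.span {H 0 0}, HV_H \<Gamma>}"
  using ideal_cases distinct_ideals span_H00_lie_ideal[OF zero] HV_H_lie_ideal[OF add] by blast

text \<open>The other proper ideals, zero and the span of \<open>H 0 0\<close>, are both contained
  in \<open>HV_H \<Gamma>\<close>.\<close>

lemma maximal_ideals: "{I. hv.maximal_lie_ideal (HV \<Gamma>) hv_bracket I} = {HV_H \<Gamma>}"
proof -
  have sub: "{0} \<subseteq> HV_H \<Gamma>" "hv.span {H 0 0} \<subseteq> HV_H \<Gamma>"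
    using zero hv.span_mono[of "{H 0 0}" "{H \<alpha> i |\<alpha> i. \<alpha> \<in> \<Gamma>}"] hv.span_zero
    by (auto simp: HV_H_def)
  have "HV_H \<Gamma> = J \<or> J = HV \<Gamma>" if "hv.lie_ideal (HV \<Gamma>) hv_bracket J" "HV_H \<Gamma> \<subseteq> J" for J
    using ideal_cases[OF that(1)] that(2) sub distinct_ideals by auto
  then have "hv.maximal_lie_ideal (HV \<Gamma>) hv_bracket (HV_H \<Gamma>)"
    unfolding hv.maximal_lie_ideal_def using distinct_ideals HV_H_lie_ideal[OF add] by auto
  moreover have "I = HV_H \<Gamma>" if "hv.maximal_lie_ideal (HV \<Gamma>) hv_bracket I" for I
  proof -
    have I: "hv.lie_ideal (HV \<Gamma>) hv_bracket I" "I \<noteq> HV \<Gamma>"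
      and max: "\<And>J. hv.lie_ideal (HV \<Gamma>) hv_bracket J \<Longrightarrow> I \<subseteq> J \<Longrightarrow> J = I \<or> J = HV \<Gamma>"
      using that by (auto simp: hv.maximal_lie_ideal_def)
    have "I \<subseteq> HV_H \<Gamma>" using ideal_cases[OF I(1)] I(2) sub by auto
    then show ?thesis using max[OF HV_H_lie_ideal[OF add]] distinct_ideals by auto
  qed
  ultimately show ?thesis by blast
qed

section \<open>Absence of a finite grading\<close>

lemma not_finitely_graded: "\<not> hv.finitely_graded TYPE('g) (HV \<Gamma>) hv_bracket"
proof
  assume "hv.finitely_graded TYPE('g) (HV \<Gamma>) hv_bracket"
  then obtain G :: "'g monoid" and D where G: "comm_group G" "hv.direct_sum_decomp (carrier G) D (HV \<Gamma>)"
    "\<And>a b x y. a \<in> carrier G \<Longrightarrow> b \<in> carrier G \<Longrightarrow> x \<in> D a \<Longrightarrow> y \<in> D b \<Longrightarrow>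
      hv_bracket x y \<in> D (a \<otimes>\<^bsub>G\<^esub> b)"
    and fd: "\<And>a. a \<in> carrier G \<Longrightarrow> hv.fin_dim_subspace (D a)"
    unfolding hv.finitely_graded_def by blast
  interpret gr: graded_lie hv_scale G "HV \<Gamma>" hv_bracket D
    using hv.lie_setting_axioms G lie_algebra_HV[OF add]
    by (intro graded_lie.intro graded_lie_axioms.intro) auto
  \<comment> \<open>These are the elements a \<partial> + h with a \<noteq> 0; all of them are
    ad-locally finite.\<close>
  define P where "P x \<longleftrightarrow> x \<in> HV \<Gamma> \<and> Lx 0 0 \<in> keys x \<and> (\<forall>\<alpha> i. Lx \<alpha> i \<in> keys x \<longrightarrow> \<alpha> = 0 \<and> i = 0)" for x
  have "P (L 0 0)" using zero by (auto simp: P_def HV_eq)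
  then obtain x where x: "P x" and min: "\<And>y. P y \<Longrightarrow> card (gr.supp x) \<le> card (gr.supp y)"
    using ex_has_least_nat[of P _ "\<lambda>x. card (gr.supp x)"] by blast
  have xV: "x \<in> HV \<Gamma>" using x by (simp add: P_def)
  have "gr.supp x \<subseteq> gr.torsion"
  proof (rule ccontr)
    assume "\<not> gr.supp x \<subseteq> gr.torsion"
    moreover have "hv.ad_locally_finite (HV \<Gamma>) hv_bracket x"
      using x unfolding P_def by (intro ad_locally_finite_of_keys) blast
    ultimately obtain u where u: "u \<in> HV \<Gamma>" "gr.supp (x - u) \<subset> gr.supp x"
      "\<And>y. y \<in> HV \<Gamma> \<Longrightarrow> \<exists>n. (hv_bracket u ^^ n) y = 0"
      using gr.extremal_part_ad_nilpotent[OF xV] by blast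
    \<comment> \<open>Ad-nilpotency excludes every \<open>L\<close> term from \<open>u\<close>, so
      subtracting \<open>u\<close> keeps the \<open>L\<close> part of \<open>x\<close> and with it
      \<open>P\<close>, contradicting minimality.\<close>
    have u_L: "Lx \<alpha> i \<notin> keys u" for \<alpha> i
      using not_ad_nilpotent[OF u(1) _ nontriv zero] u(3) by blast
    then have "lookup (x - u) (Lx \<alpha> i) = lookup x (Lx \<alpha> i)" for \<alpha> i
      by (simp add: lookup_minus in_keys_iff)
    then have "P (x - u)"
      using x hv.subspace_diff[OF HV_subspace xV u(1)] by (simp add: P_def in_keys_iff)
    then have "card (gr.supp x) \<le> card (gr.supp (x - u))" by (rule min)
    moreover have "card (gr.supp (x - u)) < card (gr.supp x)"
      using u(2) gr.finite_supp[OF xV] by (rule psubset_card_mono[rotated])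
    ultimately show False by simp
  qed
  define a where "a = lookup x (Lx 0 0)"
  have "a \<noteq> 0" using x by (simp add: P_def a_def in_keys_iff)
  \<comment> \<open>The rest of \<open>x\<close> lies in the span of the \<open>H\<close> vectors
    and commutes with \<open>H 0 n\<close>.\<close>
  have br: "hv_bracket x (H 0 n) = a *\<^sub>h hv_bracket (L 0 0) (H 0 n)" for n
  proof -
    have "hv_bracket (x - a *\<^sub>h L 0 0) (H 0 n) = 0"
    proof -
      have "\<exists>\<beta> j. k = Hx \<beta> j" if k: "k \<in> keys (x - a *\<^sub>h L 0 0)" for k
      proof (cases k)
        case (Lx \<alpha> i)
        then show ?thesis using k x
          by (cases "\<alpha> = 0 \<and> i = 0") (auto simp: P_def a_def in_keys_iff lookup_minus L_def lookup_single when_def)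
      qed auto
      then have "keys (hv_bracket (x - a *\<^sub>h L 0 0) (H 0 n)) \<subseteq> {}"
        using keys_hv_bracket[of "x - a *\<^sub>h L 0 0" "H 0 n"] by fastforce
      then show ?thesis by simp
    qed
    then show ?thesis
      using hv_bracket_add_left[of "x - a *\<^sub>h L 0 0" "a *\<^sub>h L 0 0" "H 0 n"]
      by (simp add: hv_bracket_scale_left)
  qed
  show False
  \<comment> \<open>The chain is \<open>H 0 n\<close>, that is t^n, on which \<open>x\<close> acts
    as a times d/dt.\<close>
  proof (rule gr.torsion_supp_no_jordan_chain[OF xV \<open>gr.supp x \<subseteq> gr.torsion\<close> fd])
    show "H 0 n \<in> HV \<Gamma>" for n by (rule H_in_HV[OF zero])
    show "hv_bracket x (H 0 0) = 0" by (simp add: hv_bracket_H00)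
    show "hv_bracket x (H 0 (Suc n)) = (a * of_nat (Suc n)) *\<^sub>h H 0 n" for n
      by (simp add: br hv_bracket_basis_simps)
    show "a * of_nat (Suc n) \<noteq> 0" for n
      using \<open>a \<noteq> 0\<close> of_nat_neq_0 by simp
  qed auto
qed

end

theorem theorem2p1:
  fixes \<Gamma> :: "complex set"
  assumes zero: "0 \<in> \<Gamma>"
    and add: "\<And>a b. a \<in> \<Gamma> \<Longrightarrow> b \<in> \<Gamma> \<Longrightarrow> a + b \<in> \<Gamma>"
    and neg: "\<And>a. a \<in> \<Gamma> \<Longrightarrow> - a \<in> \<Gamma>"
    and nontriv: "\<Gamma> \<noteq> {0}"
  shows "\<not> hv.finitely_graded TYPE('g) (HV \<Gamma>) hv_bracket
    \<and> {x \<in> HV \<Gamma>. hv.ad_locally_finite (HV \<Gamma>) hv_bracket x}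
        = {a *\<^sub>h L 0 0 + (\<Sum>(\<alpha>, j)\<in>S. b \<alpha> j *\<^sub>h H \<alpha> j) | a b S. finite S \<and> S \<subseteq> \<Gamma> \<times> UNIV}
    \<and> ({I. hv.lie_ideal (HV \<Gamma>) hv_bracket I \<and> I \<noteq> {0} \<and> I \<noteq> HV \<Gamma>}
          = {hv.span {H 0 0}, HV_H \<Gamma>}
       \<and> hv.span {H 0 0} \<noteq> HV_H \<Gamma>
       \<and> {I. hv.maximal_lie_ideal (HV \<Gamma>) hv_bracket I} = {HV_H \<Gamma>})"
proof -
  interpret hv_group \<Gamma> using assms by unfold_locales
  show ?thesis
    using not_finitely_graded ad_locally_finite_set[OF nontriv zero] proper_ideals
      distinct_ideals(5) maximal_ideals by blast
qed

end
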